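(* Let $T$ be a complete theory and suppose $\varphi(x,y)$ witnesses SOP$_1$ and there is no $n\in\omega$ such that $\bigwedge_{i=0}^n\varphi(x,y_i)$ witnesses SOP$_2$ (where $y_0,\dots,y_n$ are disjoint tuples of variables of the length of $y$). Then there exists $\langle b_\eta\rangle_{\eta\in{}^{\omega>}2}$ (in a monster model of $T$) such that $\langle\varphi(x,y),\langle b_\eta\rangle_{\eta\in{}^{\omega>}2}\rangle$ is an antichain tree.
   Context: ${}^{\omega>}2$ is the binary tree of finite $0/1$-sequences with initial-segment order $\trianglelefteq$. $\varphi(x,y)$ witnesses SOP$_1$ if there is $\langle a_\eta\rangle_{\eta\in{}^{\omega>}2}$ with $\{\varphi(x,a_{\eta\lceil n}):n<\omega\}$ consistent for each $\eta\in{}^\omega2$ and $\{\varphi(x,a_{\eta^\frown\langle1\rangle}),\varphi(x,a_{\eta^\frown\langle0\rangle^\frown\nu})\}$ inconsistent for all $\eta,\nu\in{}^{\omega>}2$. A formula $\psi(x,z)$ witnesses SOP$_2$ if there is $\langle c_\eta\rangle_{\eta\in{}^{\omega>}2}$ with $\{\psi(x,c_{\eta\lceil n}):n<\omega\}$ consistent for each $\eta\in{}^\omega2$ and $\{\psi(x,c_\eta),\psi(x,c_\nu)\}$ inconsistent for all $\trianglelefteq$-incomparable $\eta,\nu$. $\langle\varphi,\langle b_\eta\rangle\rangle$ is an antichain tree if for every $X\subseteq{}^{\omega>}2$, $\{\varphi(x,b_\eta):\eta\in X\}$ is consistent iff the elements of $X$ are pairwise $\trianglelefteq$-incomparable. 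*)

theory Defs
  imports Main
begin

datatype 'f trm = Var nat | Fun 'f "'f trm list"

datatype ('f, 'r) form =
    FF
  | Equ "'f trm" "'f trm"
  | Rel 'r "'f trm list"
  | Neg "('f, 'r) form"
  | Conj "('f, 'r) form" "('f, 'r) form"
  | Exi nat "('f, 'r) form"

fun fv_trm :: "'f trm \<Rightarrow> nat set" where
  "fv_trm (Var v) = {v}"
| "fv_trm (Fun f ts) = (\<Union>t\<in>set ts. fv_trm t)"

fun fv :: "('f, 'r) form \<Rightarrow> nat set" where
  "fv FF = {}"
| "fv (Equ s t) = fv_trm s \<union> fv_trm t"
| "fv (Rel r ts) = (\<Union>t\<in>set ts. fv_trm t)"
| "fv (Neg p) = fv p"
| "fv (Conj p q) = fv p \<union> fv q"
| "fv (Exi v p) = fv p - {v}"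

record ('m, 'f, 'r) struc =
  dom  :: "'m set"
  fint :: "'f \<Rightarrow> 'm list \<Rightarrow> 'm"
  rint :: "'r \<Rightarrow> 'm list \<Rightarrow> bool"

definition is_struc :: "('m, 'f, 'r) struc \<Rightarrow> bool" where
  "is_struc M \<longleftrightarrow> dom M \<noteq> {} \<and> (\<forall>f as. set as \<subseteq> dom M \<longrightarrow> fint M f as \<in> dom M)"

fun eval :: "('m, 'f, 'r) struc \<Rightarrow> (nat \<Rightarrow> 'm) \<Rightarrow> 'f trm \<Rightarrow> 'm" where
  "eval M e (Var v) = e v"
| "eval M e (Fun f ts) = fint M f (map (eval M e) ts)"

fun sat :: "('m, 'f, 'r) struc \<Rightarrow> (nat \<Rightarrow> 'm) \<Rightarrow> ('f, 'r) form \<Rightarrow> bool" where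
  "sat M e FF = False"
| "sat M e (Equ s t) = (eval M e s = eval M e t)"
| "sat M e (Rel r ts) = rint M r (map (eval M e) ts)"
| "sat M e (Neg p) = (\<not> sat M e p)"
| "sat M e (Conj p q) = (sat M e p \<and> sat M e q)"
| "sat M e (Exi v p) = (\<exists>a\<in>dom M. sat M (e(v := a)) p)"

text \<open>Aleph_1-saturation: every set of formulas in the variable v with parameters
  from a countable subset of the universe (the range of e :: nat => m, automatically countable), finitely satisfiable in M,
  is realized in M.  A monster model is in particular aleph_1-saturated.\<close>
definition aleph1_saturated :: "('m, 'f, 'r) struc \<Rightarrow> bool" where
  "aleph1_saturated M \<longleftrightarrow>
     (\<forall>(e :: nat \<Rightarrow> 'm) v (\<Sigma> :: ('f, 'r) form set).
        range e \<subseteq> dom M \<longrightarrow>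
        (\<forall>F \<subseteq> \<Sigma>. finite F \<longrightarrow> (\<exists>a\<in>dom M. \<forall>p\<in>F. sat M (e(v := a)) p)) \<longrightarrow>
        (\<exists>a\<in>dom M. \<forall>p\<in>\<Sigma>. sat M (e(v := a)) p))"

definition asg :: "(nat \<Rightarrow> 'm) \<Rightarrow> nat list \<Rightarrow> 'm list \<Rightarrow> nat \<Rightarrow> 'm" where
  "asg e vs as = fold (\<lambda>(v, a) e'. e'(v := a)) (zip vs as) e"

definition holds :: "('m, 'f, 'r) struc \<Rightarrow> ('f, 'r) form \<Rightarrow> nat list \<Rightarrow> nat list
    \<Rightarrow> 'm list \<Rightarrow> 'm list \<Rightarrow> bool" where
  "holds M \<phi> xs ys a b = sat M (asg (asg (\<lambda>_. SOME d. d \<in> dom M) xs a) ys b) \<phi>"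

text \<open>Semantics of the conjunction of phi(x,y_0),...,phi(x,y_n), the parameter
  being the concatenation y_0 ... y_n of (n+1) tuples of length l.\<close>
definition conj_rel :: "('a \<Rightarrow> 'm list \<Rightarrow> bool) \<Rightarrow> nat \<Rightarrow> nat \<Rightarrow> 'a \<Rightarrow> 'm list \<Rightarrow> bool" where
  "conj_rel R l n a c \<longleftrightarrow> length c = Suc n * l \<and> (\<forall>i\<le>n. R a (take l (drop (i * l) c)))"

text \<open>Consistency (in the monster model) of {phi(x,b) : b in B}, x a k-tuple:
  finite satisfiability in M.\<close>
definition consistent :: "('m, 'f, 'r) struc \<Rightarrow> nat \<Rightarrow> ('m list \<Rightarrow> 'm list \<Rightarrow> bool)
    \<Rightarrow> 'm list set \<Rightarrow> bool" where
  "consistent M k R B \<longleftrightarrow>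
     (\<forall>F \<subseteq> B. finite F \<longrightarrow> (\<exists>a. length a = k \<and> set a \<subseteq> dom M \<and> (\<forall>b\<in>F. R a b)))"

text \<open>Elements of the tree of finite 0/1 sequences are bool lists (False = 0,
  True = 1); branches are functions nat => bool.\<close>
definition tle :: "bool list \<Rightarrow> bool list \<Rightarrow> bool" (infix "\<unlhd>" 50) where
  "\<eta> \<unlhd> \<nu> \<longleftrightarrow> (\<exists>\<rho>. \<nu> = \<eta> @ \<rho>)"

definition restr :: "(nat \<Rightarrow> bool) \<Rightarrow> nat \<Rightarrow> bool list" where
  "restr f n = map f [0..<n]"

definition params_in :: "('m, 'f, 'r) struc \<Rightarrow> nat \<Rightarrow> (bool list \<Rightarrow> 'm list) \<Rightarrow> bool" where
  "params_in M l a \<longleftrightarrow> (\<forall>\<eta>. length (a \<eta>) = l \<and> set (a \<eta>) \<subseteq> dom M)"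

definition SOP1_witness :: "('m, 'f, 'r) struc \<Rightarrow> nat \<Rightarrow> nat \<Rightarrow> ('m list \<Rightarrow> 'm list \<Rightarrow> bool)
    \<Rightarrow> (bool list \<Rightarrow> 'm list) \<Rightarrow> bool" where
  "SOP1_witness M k l R a \<longleftrightarrow> params_in M l a \<and>
     (\<forall>f. consistent M k R {a (restr f n) | n. True}) \<and>
     (\<forall>\<eta> \<nu>. \<not> consistent M k R {a (\<eta> @ [True]), a (\<eta> @ [False] @ \<nu>)})"

definition has_SOP1 :: "('m, 'f, 'r) struc \<Rightarrow> nat \<Rightarrow> nat \<Rightarrow> ('m list \<Rightarrow> 'm list \<Rightarrow> bool) \<Rightarrow> bool" where
  "has_SOP1 M k l R \<longleftrightarrow> (\<exists>a. SOP1_witness M k l R a)"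

definition SOP2_witness :: "('m, 'f, 'r) struc \<Rightarrow> nat \<Rightarrow> nat \<Rightarrow> ('m list \<Rightarrow> 'm list \<Rightarrow> bool)
    \<Rightarrow> (bool list \<Rightarrow> 'm list) \<Rightarrow> bool" where
  "SOP2_witness M k m R c \<longleftrightarrow> params_in M m c \<and>
     (\<forall>f. consistent M k R {c (restr f n) | n. True}) \<and>
     (\<forall>\<eta> \<nu>. \<not> \<eta> \<unlhd> \<nu> \<and> \<not> \<nu> \<unlhd> \<eta> \<longrightarrow> \<not> consistent M k R {c \<eta>, c \<nu>})"

definition has_SOP2 :: "('m, 'f, 'r) struc \<Rightarrow> nat \<Rightarrow> nat \<Rightarrow> ('m list \<Rightarrow> 'm list \<Rightarrow> bool) \<Rightarrow> bool" where
  "has_SOP2 M k m R \<longleftrightarrow> (\<exists>c. SOP2_witness M k m R c)"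

definition antichain_tree :: "('m, 'f, 'r) struc \<Rightarrow> nat \<Rightarrow> ('m list \<Rightarrow> 'm list \<Rightarrow> bool)
    \<Rightarrow> (bool list \<Rightarrow> 'm list) \<Rightarrow> bool" where
  "antichain_tree M k R b \<longleftrightarrow>
     (\<forall>X. consistent M k R (b ` X) \<longleftrightarrow>
          (\<forall>\<eta>\<in>X. \<forall>\<nu>\<in>X. \<eta> \<noteq> \<nu> \<longrightarrow> \<not> \<eta> \<unlhd> \<nu> \<and> \<not> \<nu> \<unlhd> \<eta>))"

end

theory Submission
  imports Defs "HOL-Library.Ramsey" "HOL-Library.Countable" "HOL-Library.Sublist" HOL.Rat
begin

text \<open>
  Sending a sequence of naturals to a comb in the binary tree turns an SOP1 tree into a tree on
  finite sequences whose branches are consistent and in which \<open>u @ [x]\<close> is inconsistent with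
  \<open>u @ [y] @ w\<close> for \<open>x < y\<close>. By the ordinary Ramsey theorem and saturation, the labels can be taken
  rational, and consistency of a finite family of nodes made invariant under increasing
  relabelling.

  Consider configurations of several chains branching off each other, with arbitrarily long chains
  at arbitrary levels. If a consistent configuration could not be made to split at one of its
  chains, there would be an \<open>m\<close> such that all splittings with chains of length \<open>m\<close> are inconsistent.
  Spreading a long chain of the unsplit configuration over a binary tree, a block of \<open>m\<close> nodes per
  vertex, then yields SOP2 for a bounded conjunction: branches are consistent by invariance, and two
  incomparable vertices form a splitting. Hence, if no conjunction has SOP2, chains can be split
  repeatedly, and a full binary skeleton \<open>z\<close> of any finite depth is consistent.

  Decreasing the last label of each \<open>z \<eta>\<close> slightly gives an antichain tree: on an antichain this is
  an increasing relabelling, while comparable nodes become pairs \<open>u @ [x]\<close>, \<open>u @ [y] @ w\<close> with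
  \<open>x < y\<close>. Saturation passes from finite depth to the full tree.
\<close>

section \<open>Compactness in saturated models\<close>

lemma finite_fv_trm: "finite (fv_trm t)"
  by (induction t) auto

lemma finite_fv: "finite (fv p)"
  by (induction p) (auto simp: finite_fv_trm)

lemma eval_cong: "(\<And>v. v \<in> fv_trm t \<Longrightarrow> e v = e' v) \<Longrightarrow> eval M e t = eval M e' t"
proof (induction t)
  case (Fun f ts)
  then have "map (eval M e) ts = map (eval M e') ts" by (auto intro!: map_cong)
  then show ?case by (simp only: eval.simps)
qed simp

lemma sat_cong: "(\<And>v. v \<in> fv p \<Longrightarrow> e v = e' v) \<Longrightarrow> sat M e p = sat M e' p"
proof (induction p arbitrary: e e')
  case (Equ s t)
  then have "eval M e s = eval M e' s" "eval M e t = eval M e' t" by (auto intro!: eval_cong)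
  then show ?case by simp
next
  case (Rel r ts)
  then have "map (eval M e) ts = map (eval M e') ts" by (auto intro!: map_cong eval_cong)
  then show ?case by (simp only: sat.simps)
next
  case (Neg p)
  then show ?case by (metis fv.simps(4) sat.simps(4))
next
  case (Conj p q)
  have "sat M e p = sat M e' p" "sat M e q = sat M e' q"
    using Conj.prems by (auto intro!: Conj.IH)
  then show ?case by simp
next
  case (Exi v p)
  have "sat M (e(v := a)) p = sat M (e'(v := a)) p" for a
    using Exi.prems by (intro Exi.IH) auto
  then show ?case by simp
qed simp

section \<open>Finite conjunctions and blocks of existential quantifiers\<close>

definition conjs :: "('f, 'r) form list \<Rightarrow> ('f, 'r) form" where
  "conjs ps = foldr Conj ps (Neg FF)"

definition exis :: "nat list \<Rightarrow> ('f, 'r) form \<Rightarrow> ('f, 'r) form" where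
  "exis vs p = foldr Exi vs p"

lemma sat_conjs: "sat M e (conjs ps) \<longleftrightarrow> (\<forall>p\<in>set ps. sat M e p)"
  by (induction ps) (auto simp: conjs_def)

lemma sat_exis:
  "sat M e (exis vs p) \<longleftrightarrow>
     (\<exists>e'. (\<forall>v\<in>set vs. e' v \<in> dom M) \<and> (\<forall>v. v \<notin> set vs \<longrightarrow> e' v = e v) \<and> sat M e' p)"
proof (induction vs arbitrary: e)
  case Nil
  have "\<And>e'. (\<forall>v. e' v = e v) = (e' = e)" by auto
  then show ?case by (simp add: exis_def)
next
  case (Cons w vs)
  have "sat M e (exis (w # vs) p) \<longleftrightarrow> (\<exists>a\<in>dom M. sat M (e(w := a)) (exis vs p))"
    by (simp add: exis_def)
  also have "\<dots> \<longleftrightarrow> (\<exists>e'. (\<forall>v\<in>set (w # vs). e' v \<in> dom M) \<and>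
      (\<forall>v. v \<notin> set (w # vs) \<longrightarrow> e' v = e v) \<and> sat M e' p)" (is "?l = ?r")
  proof
    assume ?l
    then obtain a e' where a: "a \<in> dom M" and e': "\<forall>v\<in>set vs. e' v \<in> dom M"
      "\<forall>v. v \<notin> set vs \<longrightarrow> e' v = (e(w := a)) v" "sat M e' p"
      unfolding Cons.IH by blast
    have "e' w \<in> dom M" using a e' by (cases "w \<in> set vs") auto
    then show ?r using e' by (intro exI[of _ e']) auto
  next
    assume ?r
    then obtain e' where "\<forall>v\<in>set (w # vs). e' v \<in> dom M"
      "\<forall>v. v \<notin> set (w # vs) \<longrightarrow> e' v = e v" "sat M e' p" by blast
    then show ?l unfolding Cons.IH by (intro bexI[of _ "e' w"] exI[of _ e']) auto
  qed
  finally show ?case .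
qed

text \<open>Values for the variables 0, 1, 2, ... are chosen one at a time, keeping every finite
  part of \<open>\<Sigma>\<close> satisfiable by an extension of the choices made so far. Saturation
  supplies each next value. A formula has finitely many variables, so the limit assignment decides
  it at a finite stage.\<close>

lemma aleph1_saturated_compact:
  fixes M :: "('m, 'f, 'r) struc" and \<Sigma> :: "('f, 'r) form set"
  assumes M: "aleph1_saturated M"
    and fs: "\<And>F. F \<subseteq> \<Sigma> \<Longrightarrow> finite F \<Longrightarrow> \<exists>e. range e \<subseteq> dom M \<and> (\<forall>p\<in>F. sat M e p)"
  shows "\<exists>e. range e \<subseteq> dom M \<and> (\<forall>p\<in>\<Sigma>. sat M e p)"
proof -
  \<comment> \<open>Besides lying in the domain, only the values of \<open>e\<close> below
    \<open>n\<close> are constrained. The assignment is total because saturation is stated for total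
    assignments.\<close>
  define ok where "ok n e \<longleftrightarrow> range e \<subseteq> dom M \<and> (\<forall>F \<subseteq> \<Sigma>. finite F \<longrightarrow>
     (\<exists>e'. range e' \<subseteq> dom M \<and> (\<forall>i<n. e' i = e i) \<and> (\<forall>p\<in>F. sat M e' p)))" for n :: nat and e
  obtain e0 :: "nat \<Rightarrow> 'm" where "range e0 \<subseteq> dom M" using fs[of "{}"] by auto
  then have ok0: "ok 0 e0" unfolding ok_def using fs by auto
  have step: "\<exists>e'. ok (Suc n) e' \<and> (\<forall>i<n. e' i = e i)" if ok: "ok n e" for n e
  proof -
    have re: "range e \<subseteq> dom M" using ok by (simp add: ok_def)
    define vs where "vs ps = sorted_list_of_set (fv (conjs ps) - {..n})" for ps :: "('f, 'r) form list"
    have vs: "set (vs ps) = fv (conjs ps) - {..n}" for ps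
      by (simp add: vs_def finite_fv)
    \<comment> \<open>All variables above \<open>n\<close> are quantified away, so
      \<open>q ps\<close> is a condition on the variable \<open>n\<close> over the values already
      fixed. These conditions form the type to be realized.\<close>
    define q where "q ps = exis (vs ps) (conjs ps)" for ps
    have "\<exists>a\<in>dom M. \<forall>p\<in>q ` {ps. set ps \<subseteq> \<Sigma>}. sat M (e(n := a)) p"
    proof (rule M[unfolded aleph1_saturated_def, rule_format, OF re])
      fix G assume "G \<subseteq> q ` {ps. set ps \<subseteq> \<Sigma>}" "finite G"
      then obtain P where P: "P \<subseteq> {ps. set ps \<subseteq> \<Sigma>}" "finite P" "G = q ` P"
        by (meson finite_subset_image)
      have "(\<Union>ps\<in>P. set ps) \<subseteq> \<Sigma>" "finite (\<Union>ps\<in>P. set ps)" using P by auto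
      then obtain e' where e': "range e' \<subseteq> dom M" "\<forall>i<n. e' i = e i"
        "\<forall>p\<in>(\<Union>ps\<in>P. set ps). sat M e' p"
        using ok[unfolded ok_def, THEN conjunct2, rule_format, of "\<Union>ps\<in>P. set ps"] by auto
      have "sat M (e(n := e' n)) (q ps)" if ps: "ps \<in> P" for ps
      proof -
        define e'' where "e'' = (\<lambda>v. if v \<in> set (vs ps) then e' v else (e(n := e' n)) v)"
        have "e'' v = e' v" if "v \<in> fv (conjs ps)" for v
          using that e'(2) by (auto simp: e''_def vs)
        then have "sat M e'' (conjs ps) = sat M e' (conjs ps)" by (rule sat_cong)
        then have "sat M e'' (conjs ps)" using e'(3) ps by (auto simp: sat_conjs)
        then show ?thesis unfolding q_def sat_exis
          using e'(1) by (intro exI[of _ e'']) (auto simp: e''_def)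
      qed
      then show "\<exists>a\<in>dom M. \<forall>p\<in>G. sat M (e(n := a)) p"
        using e'(1) P(3) by (intro bexI[of _ "e' n"]) auto
    qed
    then obtain a where a: "a \<in> dom M" "\<And>ps. set ps \<subseteq> \<Sigma> \<Longrightarrow> sat M (e(n := a)) (q ps)"
      by auto
    have "ok (Suc n) (e(n := a))"
      unfolding ok_def
    proof (intro conjI allI impI)
      show "range (e(n := a)) \<subseteq> dom M" using re a(1) by auto
      fix F assume "F \<subseteq> \<Sigma>" "finite F"
      then obtain ps where ps: "set ps = F" using finite_list by blast
      then obtain e' where e': "\<forall>v\<in>set (vs ps). e' v \<in> dom M"
        "\<forall>v. v \<notin> set (vs ps) \<longrightarrow> e' v = (e(n := a)) v" "sat M e' (conjs ps)"
        using a(2)[of ps] \<open>F \<subseteq> \<Sigma>\<close> unfolding q_def sat_exis by blast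
      have "e' v \<in> dom M" for v
        using e'(1,2) re a(1) by (cases "v \<in> set (vs ps)") auto
      moreover have "\<forall>i<Suc n. e' i = (e(n := a)) i" using e'(2) by (auto simp: vs)
      moreover have "\<forall>p\<in>F. sat M e' p" using e'(3) ps by (simp add: sat_conjs)
      ultimately show "\<exists>e'. range e' \<subseteq> dom M \<and> (\<forall>i<Suc n. e' i = (e(n := a)) i) \<and> (\<forall>p\<in>F. sat M e' p)"
        by blast
    qed
    then show ?thesis by (intro exI[of _ "e(n := a)"]) auto
  qed
  obtain E where E: "\<And>n. ok n (E n)" "\<And>n i. i < n \<Longrightarrow> E (Suc n) i = E n i"
    using dependent_nat_choice[of ok "\<lambda>n e e'. \<forall>i<n. e' i = e i"] ok0 step by metis
  \<comment> \<open>The diagonal limit: the value at \<open>i\<close> is frozen from stage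
    \<open>i + 1\<close> on.\<close>
  define e where "e i = E (Suc i) i" for i
  have eq: "E n i = e i" if "i < n" for n i
    using that
  proof (induction n)
    case (Suc n)
    then show ?case using E(2)[of i n] by (cases "i = n") (auto simp: e_def)
  qed simp
  have "range e \<subseteq> dom M" using E(1) unfolding ok_def e_def by blast
  moreover have "sat M e p" if p: "p \<in> \<Sigma>" for p
  proof -
    obtain n where n: "\<forall>v\<in>fv p. v < n" using finite_fv[of p] finite_nat_set_iff_bounded by blast
    obtain e' where "\<forall>i<n. e' i = E n i" "sat M e' p"
      using E(1)[of n] p unfolding ok_def by (metis empty_subsetI finite.emptyI finite.insertI insert_subset singletonI)
    moreover have "sat M e' p = sat M e p"
      by (rule sat_cong) (use calculation n eq in auto)
    ultimately show ?thesis by simp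
  qed
  ultimately show ?thesis by blast
qed

section \<open>Joint satisfiability of parameter tuples and its coding by formulas\<close>

definition jointly_sat :: "('m, 'f, 'r) struc \<Rightarrow> nat \<Rightarrow> ('m list \<Rightarrow> 'm list \<Rightarrow> bool) \<Rightarrow> 'm list set \<Rightarrow> bool"
  where "jointly_sat M k R B \<longleftrightarrow> (\<exists>a. length a = k \<and> set a \<subseteq> dom M \<and> (\<forall>b\<in>B. R a b))"

lemma jointly_sat_mono: "jointly_sat M k R B \<Longrightarrow> B' \<subseteq> B \<Longrightarrow> jointly_sat M k R B'"
  unfolding jointly_sat_def by blast

lemma consistent_iff: "consistent M k R B \<longleftrightarrow> (\<forall>F \<subseteq> B. finite F \<longrightarrow> jointly_sat M k R F)"
  unfolding consistent_def jointly_sat_def ..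

lemma consistent_finite_iff: "finite B \<Longrightarrow> consistent M k R B \<longleftrightarrow> jointly_sat M k R B"
  unfolding consistent_iff by (meson jointly_sat_mono order_refl)

lemma asg_notin: "v \<notin> set vs \<Longrightarrow> asg e vs as v = e v"
proof (induction vs arbitrary: e as)
  case (Cons w vs)
  then show ?case by (cases as) (auto simp: asg_def)
qed (simp add: asg_def)

lemma asg_nth:
  "distinct vs \<Longrightarrow> length as = length vs \<Longrightarrow> j < length vs \<Longrightarrow> asg e vs as (vs ! j) = as ! j"
proof (induction vs arbitrary: e as j)
  case (Cons w vs)
  then obtain a as' where as: "as = a # as'" by (cases as) auto
  have *: "asg e (w # vs) (a # as') = asg (e(w := a)) vs as'" by (simp add: asg_def)
  show ?case using Cons by (cases j) (auto simp: * as asg_notin)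
qed simp

text \<open>Replaces the specific nested assignment inside \<open>holds\<close> by any assignment
  with the right values on \<open>xs\<close> and \<open>ys\<close>, since no other variable is free
  in \<open>\<phi>\<close>.\<close>

lemma holds_iff_sat:
  assumes "distinct xs" "distinct ys" "set xs \<inter> set ys = {}" "fv \<phi> \<subseteq> set xs \<union> set ys"
    and "length a = length xs" "length b = length ys"
    and ex: "\<And>j. j < length xs \<Longrightarrow> e (xs ! j) = a ! j"
    and ey: "\<And>j. j < length ys \<Longrightarrow> e (ys ! j) = b ! j"
  shows "holds M \<phi> xs ys a b \<longleftrightarrow> sat M e \<phi>"
  unfolding holds_def
proof (rule sat_cong)
  fix v assume "v \<in> fv \<phi>"
  then consider "v \<in> set ys" | "v \<in> set xs" "v \<notin> set ys" using assms by auto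
  then show "asg (asg (\<lambda>_. SOME d. d \<in> dom M) xs a) ys b v = e v"
  proof cases
    case 1
    then obtain j where "j < length ys" "v = ys ! j" by (auto simp: in_set_conv_nth)
    then show ?thesis using assms by (simp add: asg_nth)
  next
    case 2
    then obtain j where "j < length xs" "v = xs ! j" by (auto simp: in_set_conv_nth)
    then show ?thesis using assms 2 by (simp add: asg_nth asg_notin)
  qed
qed

text \<open>An infinite family of unknown tuples is coded by one assignment, the tuple with index
  \<open>i\<close> occupying the \<open>i\<close>-th block of \<open>l\<close> fresh variables.
  Joint satisfiability over a finite \<open>X\<close> is then a formula \<open>\<psi> X\<close>, and
  compactness applies to these formulas and their negations.\<close>

lemma jointly_sat_compact:
  fixes M :: "('m, 'f, 'r) struc" and T G :: "nat set set"
  assumes "is_struc M" and sat: "aleph1_saturated M"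
    and vars: "distinct xs" "distinct ys" "set xs \<inter> set ys = {}" "fv \<phi> \<subseteq> set xs \<union> set ys"
    and k: "k = length xs" and l: "l = length ys" and R: "R = holds M \<phi> xs ys"
    and D: "D = {b. length b = l \<and> set b \<subseteq> dom M}"
    and fin: "\<And>X. X \<in> T \<union> G \<Longrightarrow> finite X"
    and fs: "\<And>T0 G0. T0 \<subseteq> T \<Longrightarrow> G0 \<subseteq> G \<Longrightarrow> finite T0 \<Longrightarrow> finite G0 \<Longrightarrow>
       \<exists>b. range b \<subseteq> D \<and> (\<forall>X\<in>T0. jointly_sat M k R (b ` X)) \<and> (\<forall>X\<in>G0. \<not> jointly_sat M k R (b ` X))"
  shows "\<exists>b. range b \<subseteq> D \<and> (\<forall>X\<in>T. jointly_sat M k R (b ` X)) \<and> (\<forall>X\<in>G. \<not> jointly_sat M k R (b ` X))"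
proof -
  \<comment> \<open>The blocks start at \<open>N\<close>, clear of the variables of
    \<open>\<phi>\<close>.\<close>
  obtain N where N: "\<forall>v\<in>set xs \<union> set ys. v < N"
    using finite_nat_set_iff_bounded[of "set xs \<union> set ys"] by auto
  define tup where "tup e i = map (\<lambda>j. e (N + i * l + j)) [0..<l]" for e :: "nat \<Rightarrow> 'm" and i
  \<comment> \<open>This expresses \<phi>(x, block i). Quantifying over \<open>ys\<close> and
    equating them with the block replaces substitution into \<open>\<phi>\<close>.\<close>
  define \<chi> where "\<chi> i = exis ys (conjs (map (\<lambda>j. Equ (Var (ys ! j)) (Var (N + i * l + j))) [0..<l] @ [\<phi>]))" for i
  define \<psi> where "\<psi> X = exis xs (conjs (map \<chi> (sorted_list_of_set X)))" for X
  have \<chi>: "sat M e (\<chi> i) \<longleftrightarrow> holds M \<phi> xs ys (map e xs) (tup e i)" if re: "range e \<subseteq> dom M" for e i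
  proof -
    have tup_upd: "e' (N + i * l + j) = tup e i ! j"
      if "\<forall>v. v \<notin> set ys \<longrightarrow> e' v = e v" "j < l" for e' j
    proof -
      have "N + i * l + j \<notin> set ys" using N by (metis UnI2 add.assoc not_add_less1)
      then show ?thesis using that by (simp add: tup_def)
    qed
    show ?thesis
    proof
      assume "sat M e (\<chi> i)"
      then obtain e' where e': "\<forall>v. v \<notin> set ys \<longrightarrow> e' v = e v" "sat M e' \<phi>"
        "\<forall>j<l. e' (ys ! j) = e' (N + i * l + j)"
        unfolding \<chi>_def sat_exis sat_conjs by auto
      have "e' (xs ! j) = map e xs ! j" if "j < length xs" for j
      proof -
        have "xs ! j \<notin> set ys" using that vars(3) nth_mem by blast
        then show ?thesis using that e'(1) by simp
      qed
      then show "holds M \<phi> xs ys (map e xs) (tup e i)"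
        using e' tup_upd[OF e'(1)]
        by (subst holds_iff_sat[where e = e']) (auto simp: vars l tup_def)
    next
      assume h: "holds M \<phi> xs ys (map e xs) (tup e i)"
      let ?e = "asg e ys (tup e i)"
      have len: "length (tup e i) = length ys" by (simp add: tup_def l)
      have nys: "\<forall>v. v \<notin> set ys \<longrightarrow> ?e v = e v" by (simp add: asg_notin)
      have ye: "?e (ys ! j) = tup e i ! j" if "j < l" for j
        using that len vars by (simp add: asg_nth l)
      have "?e (xs ! j) = map e xs ! j" if "j < length xs" for j
      proof -
        have "xs ! j \<notin> set ys" using that vars(3) nth_mem by blast
        then show ?thesis using that by (simp add: asg_notin)
      qed
      then have "sat M ?e \<phi>" using h ye len
        by (subst (asm) holds_iff_sat[where e = ?e]) (auto simp: vars l)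
      moreover have "?e v \<in> dom M" if v: "v \<in> set ys" for v
      proof -
        obtain j where "j < l" "v = ys ! j" using v l by (auto simp: in_set_conv_nth)
        then show ?thesis using ye[of j] re by (auto simp: tup_def)
      qed
      ultimately show "sat M e (\<chi> i)"
        unfolding \<chi>_def sat_exis sat_conjs using nys ye tup_upd[OF nys]
        by (intro exI[of _ ?e]) auto
    qed
  qed
  have \<psi>: "sat M e (\<psi> X) \<longleftrightarrow> jointly_sat M k R (tup e ` X)" if re: "range e \<subseteq> dom M" and X: "finite X" for e X
  proof -
    have tup_eq: "tup e' i = tup e i" if "\<forall>v. v \<notin> set xs \<longrightarrow> e' v = e v" for e' i
    proof -
      have "N + i * l + j \<notin> set xs" for j using N by (metis UnI1 add.assoc not_add_less1)
      then show ?thesis using that by (simp add: tup_def)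
    qed
    show ?thesis
    proof
      assume "sat M e (\<psi> X)"
      then obtain e' where e': "\<forall>v\<in>set xs. e' v \<in> dom M" "\<forall>v. v \<notin> set xs \<longrightarrow> e' v = e v"
        "\<forall>i\<in>X. sat M e' (\<chi> i)"
        unfolding \<psi>_def sat_exis sat_conjs using X by auto
      have "range e' \<subseteq> dom M" using e'(1,2) re by (metis image_subset_iff)
      then have "\<forall>i\<in>X. R (map e' xs) (tup e i)" using e'(3) \<chi> tup_eq[OF e'(2)] R by auto
      then show "jointly_sat M k R (tup e ` X)" unfolding jointly_sat_def
        using e'(1) k by (intro exI[of _ "map e' xs"]) auto
    next
      assume "jointly_sat M k R (tup e ` X)"
      then obtain a where a: "length a = k" "set a \<subseteq> dom M" "\<forall>i\<in>X. R a (tup e i)"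
        unfolding jointly_sat_def by auto
      let ?e = "asg e xs a"
      have nxs: "\<forall>v. v \<notin> set xs \<longrightarrow> ?e v = e v" by (simp add: asg_notin)
      have map_e: "map ?e xs = a" using a k vars by (intro nth_equalityI) (auto simp: asg_nth)
      have "?e v \<in> dom M" if "v \<in> set xs" for v
        using that map_e a(2) by (metis image_eqI list.set_map subsetD)
      moreover from this have "range ?e \<subseteq> dom M" using re nxs by (metis image_subset_iff)
      then have "\<forall>i\<in>X. sat M ?e (\<chi> i)" using a(3) \<chi> tup_eq[OF nxs] R map_e by auto
      ultimately show "sat M e (\<psi> X)"
        unfolding \<psi>_def sat_exis sat_conjs using nxs X by (intro exI[of _ ?e]) auto
    qed
  qed
  obtain d where d: "d \<in> dom M" using \<open>is_struc M\<close> by (auto simp: is_struc_def)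
  have "\<exists>e. range e \<subseteq> dom M \<and> (\<forall>p\<in>\<psi> ` T \<union> (\<lambda>X. Neg (\<psi> X)) ` G. sat M e p)"
  proof (rule aleph1_saturated_compact[OF sat])
    fix F assume F: "F \<subseteq> \<psi> ` T \<union> (\<lambda>X. Neg (\<psi> X)) ` G" "finite F"
    obtain T0 where T0: "T0 \<subseteq> T" "finite T0" "F \<inter> \<psi> ` T = \<psi> ` T0"
      using finite_subset_image[of "F \<inter> \<psi> ` T" \<psi> T] F(2) by blast
    obtain G0 where G0: "G0 \<subseteq> G" "finite G0" "F \<inter> (\<lambda>X. Neg (\<psi> X)) ` G = (\<lambda>X. Neg (\<psi> X)) ` G0"
      using finite_subset_image[of "F \<inter> (\<lambda>X. Neg (\<psi> X)) ` G" "\<lambda>X. Neg (\<psi> X)" G] F(2) by blast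
    obtain b where b: "range b \<subseteq> D" "\<forall>X\<in>T0. jointly_sat M k R (b ` X)" "\<forall>X\<in>G0. \<not> jointly_sat M k R (b ` X)"
      using fs[OF T0(1) G0(1) T0(2) G0(2)] by blast
    have bD: "length (b i) = l" "set (b i) \<subseteq> dom M" for i using b(1) D by auto
    \<comment> \<open>Division with remainder recovers block and position from a variable. For
      \<open>l = 0\<close> there are no blocks, and the default \<open>d\<close> keeps the range in
      the domain.\<close>
    define e where "e v = (if v < N \<or> l = 0 then d else b ((v - N) div l) ! ((v - N) mod l))" for v
    have re: "range e \<subseteq> dom M"
    proof
      fix y assume "y \<in> range e"
      then obtain v where v: "y = e v" by auto
      show "y \<in> dom M"
      proof (cases "v < N \<or> l = 0")
        case False
        then have "(v - N) mod l < length (b ((v - N) div l))" using bD by simp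
        then have "y \<in> set (b ((v - N) div l))" using False v by (simp add: e_def)
        then show ?thesis using bD(2) by blast
      qed (use v d in \<open>auto simp: e_def\<close>)
    qed
    have "tup e = b"
    proof
      fix i
      show "tup e i = b i"
      proof (rule nth_equalityI)
        fix j assume "j < length (tup e i)"
        then have "j < l" by (simp add: tup_def)
        then show "tup e i ! j = b i ! j" by (simp add: tup_def e_def add.assoc)
      qed (simp add: tup_def bD)
    qed
    then have "\<forall>p\<in>\<psi> ` T0 \<union> (\<lambda>X. Neg (\<psi> X)) ` G0. sat M e p"
      using b(2,3) T0(1) G0(1) fin \<psi>[OF re] by auto
    moreover have "F = (F \<inter> \<psi> ` T) \<union> (F \<inter> (\<lambda>X. Neg (\<psi> X)) ` G)" using F(1) by (simp add: Int_Un_distrib[symmetric] inf.absorb1)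
    then have "F = \<psi> ` T0 \<union> (\<lambda>X. Neg (\<psi> X)) ` G0" unfolding T0(3) G0(3) .
    ultimately have "\<forall>p\<in>F. sat M e p" by simp
    then show "\<exists>e. range e \<subseteq> dom M \<and> (\<forall>p\<in>F. sat M e p)" using re by blast
  qed
  then obtain e where e: "range e \<subseteq> dom M"
    and eTG: "\<forall>p\<in>\<psi> ` T \<union> (\<lambda>X. Neg (\<psi> X)) ` G. sat M e p" by blast
  have eT: "sat M e (\<psi> X)" if "X \<in> T" for X using that eTG by simp
  have eG: "\<not> sat M e (\<psi> X)" if "X \<in> G" for X
    using that eTG sat.simps(4)[of M e "\<psi> X"] by blast
  have "e v \<in> dom M" for v using e by blast
  then have "range (tup e) \<subseteq> D" by (auto simp: D tup_def)
  moreover have "jointly_sat M k R (tup e ` X)" if "X \<in> T" for X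
    using eT[OF that] \<psi>[OF e fin] that by blast
  moreover have "\<not> jointly_sat M k R (tup e ` X)" if "X \<in> G" for X
    using eG[OF that] \<psi>[OF e fin] that by blast
  ultimately show ?thesis by blast
qed

section \<open>Indiscernible trees\<close>

definition labels :: "'l list set \<Rightarrow> 'l set" where
  "labels F = (\<Union>s\<in>F. set s)"

lemma finite_labels: "finite F \<Longrightarrow> finite (labels F)"
  by (simp add: labels_def)

lemma map_image_cong_labels:
  "(\<And>x. x \<in> labels F \<Longrightarrow> \<rho> x = \<rho>' x) \<Longrightarrow> map \<rho> ` F = map \<rho>' ` F"
  unfolding labels_def by (intro image_cong refl map_cong) auto

text \<open>Both maps list the common image in increasing order, and a finite set has only one such
  listing.\<close>

lemma strict_mono_on_finite_unique:
  fixes \<rho> \<rho>' :: "'l::linorder \<Rightarrow> 'k::linorder"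
  assumes "finite L" "strict_mono_on L \<rho>" "strict_mono_on L \<rho>'" "\<rho> ` L = \<rho>' ` L" "x \<in> L"
  shows "\<rho> x = \<rho>' x"
proof -
  have *: "map \<sigma> (sorted_list_of_set L) = sorted_list_of_set (\<sigma> ` L)"
    if "strict_mono_on L \<sigma>" for \<sigma> :: "'l \<Rightarrow> 'k"
  proof (rule strict_sorted_equal)
    have "sorted_wrt (\<lambda>x y. \<sigma> x < \<sigma> y) (sorted_list_of_set L)"
      by (rule sorted_wrt_mono_rel[OF _ sorted_list_of_set.strict_sorted_key_list_of_set])
        (use that assms(1) in \<open>auto simp: strict_mono_on_def\<close>)
    then show "sorted_wrt (<) (map \<sigma> (sorted_list_of_set L))" by (simp add: sorted_wrt_map)
  qed (use assms(1) in auto)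
  have "map \<rho> (sorted_list_of_set L) = map \<rho>' (sorted_list_of_set L)"
    using assms by (simp add: *)
  then show ?thesis using assms(1,5) by simp
qed

text \<open>The element with exactly \<open>r\<close> predecessors in \<open>L\<close> goes to the
  \<open>r\<close>-th element of \<open>H\<close>.\<close>

lemma ex_strict_mono_on_into_infinite:
  fixes H :: "nat set" and L :: "'l::linorder set"
  assumes "finite L" "infinite H"
  shows "\<exists>\<rho>. strict_mono_on L \<rho> \<and> range \<rho> \<subseteq> H"
proof -
  define \<rho> where "\<rho> l = enumerate H (card {x \<in> L. x < l})" for l
  have "strict_mono_on L \<rho>"
  proof (rule strict_mono_onI)
    fix x y assume "x \<in> L" "y \<in> L" "x < y"
    then have "{z \<in> L. z < x} \<subset> {z \<in> L. z < y}" by auto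
    then have "card {z \<in> L. z < x} < card {z \<in> L. z < y}"
      using assms(1) by (intro psubset_card_mono) auto
    then show "\<rho> x < \<rho> y" unfolding \<rho>_def using assms(2) by (rule enumerate_mono)
  qed
  then show ?thesis using assms(2) by (auto simp: \<rho>_def enumerate_in_set)
qed

text \<open>Ramsey's theorem for subsets of the size of the label set: a subset is coloured by
  whether \<open>Q\<close> holds of the increasing copy of \<open>F\<close> with exactly these
  labels.\<close>

lemma ex_homogeneous_for_family:
  fixes F :: "'l::linorder list set" and H :: "nat set"
  assumes "finite F" "infinite H"
  shows "\<exists>H' \<subseteq> H. infinite H' \<and>
     ((\<forall>\<rho>. strict_mono_on (labels F) \<rho> \<and> \<rho> ` labels F \<subseteq> H' \<longrightarrow> Q (map \<rho> ` F)) \<or>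
      (\<forall>\<rho>. strict_mono_on (labels F) \<rho> \<and> \<rho> ` labels F \<subseteq> H' \<longrightarrow> \<not> Q (map \<rho> ` F)))"
proof -
  let ?L = "labels F"
  have L: "finite ?L" using assms(1) by (rule finite_labels)
  define f :: "nat set \<Rightarrow> nat" where
    "f X = (if \<exists>\<rho>. strict_mono_on ?L \<rho> \<and> \<rho> ` ?L = X \<and> Q (map \<rho> ` F) then 1 else 0)" for X
  \<comment> \<open>The existential in the colouring is harmless: an increasing relabelling is
    determined by its image, so there is only one copy on each label set.\<close>
  have f: "f (\<rho> ` ?L) = 1 \<longleftrightarrow> Q (map \<rho> ` F)" if \<rho>: "strict_mono_on ?L \<rho>" for \<rho>
  proof -
    have "map \<rho>' ` F = map \<rho> ` F" if "strict_mono_on ?L \<rho>'" "\<rho>' ` ?L = \<rho> ` ?L" for \<rho>'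
      by (rule map_image_cong_labels) (rule strict_mono_on_finite_unique[OF L that(1) \<rho> that(2)])
    moreover have "f (\<rho> ` ?L) = 1 \<longleftrightarrow> (\<exists>\<rho>'. strict_mono_on ?L \<rho>' \<and> \<rho>' ` ?L = \<rho> ` ?L \<and> Q (map \<rho>' ` F))"
      by (simp add: f_def)
    ultimately show ?thesis using \<rho> by metis
  qed
  have "\<exists>Y t. Y \<subseteq> H \<and> infinite Y \<and> t < 2 \<and> (\<forall>X. X \<subseteq> Y \<and> finite X \<and> card X = card ?L \<longrightarrow> f X = t)"
    by (rule Ramsey[OF assms(2)]) (simp add: f_def)
  then obtain Y t where "Y \<subseteq> H \<and> infinite Y \<and> t < 2 \<and>
      (\<forall>X. X \<subseteq> Y \<and> finite X \<and> card X = card ?L \<longrightarrow> f X = t)" by (elim exE)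
  then have Y: "Y \<subseteq> H" "infinite Y"
    "\<And>X. X \<subseteq> Y \<Longrightarrow> finite X \<Longrightarrow> card X = card ?L \<Longrightarrow> f X = t" by simp_all
  have eq: "f (\<rho> ` ?L) = t" if "strict_mono_on ?L \<rho>" "\<rho> ` ?L \<subseteq> Y" for \<rho>
    using that L strict_mono_on_imp_inj_on[OF that(1)] by (intro Y(3)) (auto simp: card_image)
  show ?thesis
  proof (cases "t = 1")
    case True
    then have "Q (map \<rho> ` F)" if "strict_mono_on ?L \<rho>" "\<rho> ` ?L \<subseteq> Y" for \<rho>
      using f[OF that(1)] eq[OF that] by simp
    then show ?thesis using Y(1,2) by (intro exI[of _ Y]) simp
  next
    case False
    then have "\<not> Q (map \<rho> ` F)" if "strict_mono_on ?L \<rho>" "\<rho> ` ?L \<subseteq> Y" for \<rho>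
      using f[OF that(1)] eq[OF that] by simp
    then show ?thesis using Y(1,2) by (intro exI[of _ Y]) simp
  qed
qed

text \<open>Here \<open>D\<close> stands for the parameter tuples of the right length and
  \<open>C\<close> for joint satisfiability. \<open>T\<close> lists the index sets demanded
  consistent, \<open>G\<close> those demanded inconsistent, so both kinds of demand are subject to
  compactness.\<close>

locale compact_consistency =
  fixes D :: "'p set" and C :: "'p set \<Rightarrow> bool"
  assumes C_mono: "C B \<Longrightarrow> B' \<subseteq> B \<Longrightarrow> C B'"
    and compact_nat: "\<And>(T :: nat set set) G.
      (\<And>X. X \<in> T \<union> G \<Longrightarrow> finite X) \<Longrightarrow>
      (\<And>T0 G0. T0 \<subseteq> T \<Longrightarrow> G0 \<subseteq> G \<Longrightarrow> finite T0 \<Longrightarrow> finite G0 \<Longrightarrow>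
         \<exists>b. range b \<subseteq> D \<and> (\<forall>X\<in>T0. C (b ` X)) \<and> (\<forall>X\<in>G0. \<not> C (b ` X))) \<Longrightarrow>
      \<exists>b. range b \<subseteq> D \<and> (\<forall>X\<in>T. C (b ` X)) \<and> (\<forall>X\<in>G. \<not> C (b ` X))"
begin

text \<open>The parameter tuple at node \<open>\<eta>\<close> is \<open>t \<eta> 0, \<dots>, t \<eta> n\<close>; values at deeper nodes and
  larger indices are junk.\<close>
definition SOP2_tree_to :: "nat \<Rightarrow> nat \<Rightarrow> (bool list \<Rightarrow> nat \<Rightarrow> 'p) \<Rightarrow> bool" where
  "SOP2_tree_to n d t \<longleftrightarrow> (\<forall>\<eta>. t \<eta> ` {..n} \<subseteq> D) \<and>
     (\<forall>\<eta>. length \<eta> = d \<longrightarrow> C (\<Union>\<sigma>\<in>{\<sigma>. prefix \<sigma> \<eta>}. t \<sigma> ` {..n})) \<and>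
     (\<forall>\<eta> \<nu>. length \<eta> \<le> d \<longrightarrow> length \<nu> \<le> d \<longrightarrow> \<eta> \<parallel> \<nu> \<longrightarrow> \<not> C (t \<eta> ` {..n} \<union> t \<nu> ` {..n}))"

text \<open>Transport along \<open>to_nat\<close>. The index sets arising below are sequences of
  rationals, binary sequences, and pairs of a binary sequence and a number.\<close>

lemma compact:
  fixes T G :: "'i::countable set set"
  assumes fin: "\<And>X. X \<in> T \<union> G \<Longrightarrow> finite X"
    and fs: "\<And>T0 G0. T0 \<subseteq> T \<Longrightarrow> G0 \<subseteq> G \<Longrightarrow> finite T0 \<Longrightarrow> finite G0 \<Longrightarrow>
         \<exists>b. range b \<subseteq> D \<and> (\<forall>X\<in>T0. C (b ` X)) \<and> (\<forall>X\<in>G0. \<not> C (b ` X))"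
  shows "\<exists>b. range b \<subseteq> D \<and> (\<forall>X\<in>T. C (b ` X)) \<and> (\<forall>X\<in>G. \<not> C (b ` X))"
proof -
  have "\<exists>b. range b \<subseteq> D \<and> (\<forall>X\<in>image to_nat ` T. C (b ` X)) \<and> (\<forall>X\<in>image to_nat ` G. \<not> C (b ` X))"
  proof (rule compact_nat)
    fix X assume "X \<in> image to_nat ` T \<union> image to_nat ` G"
    then show "finite X" using fin by auto
  next
    fix T0 G0 assume "T0 \<subseteq> image to_nat ` T" "G0 \<subseteq> image to_nat ` G" "finite T0" "finite G0"
    then obtain T1 G1 where 1: "T1 \<subseteq> T" "finite T1" "T0 = image to_nat ` T1"
      "G1 \<subseteq> G" "finite G1" "G0 = image to_nat ` G1"
      by (meson finite_subset_image)
    then obtain b where b: "range b \<subseteq> D" "\<forall>X\<in>T1. C (b ` X)" "\<forall>X\<in>G1. \<not> C (b ` X)"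
      using fs by meson
    have [simp]: "(\<lambda>n. b (from_nat n)) ` to_nat ` X = b ` X" for X by (simp add: image_image)
    show "\<exists>b. range b \<subseteq> D \<and> (\<forall>X\<in>T0. C (b ` X)) \<and> (\<forall>X\<in>G0. \<not> C (b ` X))"
      using b 1 by (intro exI[of _ "\<lambda>n. b (from_nat n)"]) auto
  qed
  then obtain b where b: "range b \<subseteq> D" "\<forall>X\<in>T. C (b ` to_nat ` X)" "\<forall>X\<in>G. \<not> C (b ` to_nat ` X)"
    by auto
  then show ?thesis by (intro exI[of _ "\<lambda>i. b (to_nat i)"]) (auto simp: image_image)
qed

text \<open>Every finite family of rational sequences has either eventually consistent or eventually
  inconsistent copies in \<open>A0\<close>, along a decreasing chain of homogeneous sets. Giving
  each family in \<open>A\<close> its eventual behaviour is finitely satisfiable, hence possible,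
  and this behaviour is invariant under increasing relabelling.\<close>

lemma ex_indiscernible:
  fixes A0 :: "nat list \<Rightarrow> 'p"
  assumes D: "range A0 \<subseteq> D"
    and P: "\<And>s. C (A0 ` {t. prefix t s})"
    and I: "\<And>u x y w. x < y \<Longrightarrow> \<not> C {A0 (u @ [x]), A0 (u @ [y] @ w)}"
  shows "\<exists>A :: rat list \<Rightarrow> 'p. range A \<subseteq> D \<and> (\<forall>s. C (A ` {t. prefix t s})) \<and>
    (\<forall>u x y w. x < y \<longrightarrow> \<not> C {A (u @ [x]), A (u @ [y] @ w)}) \<and>
    (\<forall>F \<pi>. finite F \<longrightarrow> strict_mono_on (labels F) \<pi> \<longrightarrow> C (A ` F) \<longrightarrow> C (A ` map \<pi> ` F))"
proof -
  define copy :: "rat list set \<Rightarrow> nat set \<Rightarrow> (rat \<Rightarrow> nat) \<Rightarrow> bool" where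
    "copy F H \<rho> \<longleftrightarrow> strict_mono_on (labels F) \<rho> \<and> \<rho> ` labels F \<subseteq> H" for F H \<rho>
  \<comment> \<open>Enumerates the finite families through the countable type of lists of
    sequences.\<close>
  define fam :: "nat \<Rightarrow> rat list set" where "fam k = set (from_nat k)" for k
  define hom where "hom F H \<longleftrightarrow> (\<forall>\<rho>. copy F H \<rho> \<longrightarrow> C (A0 ` map \<rho> ` F)) \<or>
       (\<forall>\<rho>. copy F H \<rho> \<longrightarrow> \<not> C (A0 ` map \<rho> ` F))" for F H
  have step: "\<exists>H'. infinite H' \<and> H' \<subseteq> H \<and> hom (fam k) H'" if "infinite H" for H k
    using ex_homogeneous_for_family[of "fam k" H "\<lambda>G. C (A0 ` G)"] that
    unfolding hom_def copy_def fam_def by auto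
  obtain H where H: "\<And>k. infinite (H k)" "\<And>k. H (Suc k) \<subseteq> H k \<and> hom (fam k) (H (Suc k))"
    using dependent_nat_choice[of "\<lambda>_ H. infinite H" "\<lambda>k H H'. H' \<subseteq> H \<and> hom (fam k) H'"]
      step infinite_UNIV_nat by (metis (no_types, lifting))
  have H_mono: "H m \<subseteq> H k" if "k \<le> m" for k m
    using that by (rule lift_Suc_antimono_le[of H, rotated]) (use H in auto)
  define ev where "ev F \<longleftrightarrow> (\<exists>k. \<forall>\<rho>. copy F (H k) \<rho> \<longrightarrow> C (A0 ` map \<rho> ` F))" for F
  define en where "en F \<longleftrightarrow> (\<exists>k. \<forall>\<rho>. copy F (H k) \<rho> \<longrightarrow> \<not> C (A0 ` map \<rho> ` F))" for F
  have ev_or_en: "ev F \<or> en F" if "finite F" for F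
  proof -
    obtain fs where "set fs = F" using \<open>finite F\<close> finite_list by blast
    then have "fam (to_nat fs) = F" by (simp add: fam_def)
    then show ?thesis using H(2)[of "to_nat fs"] unfolding hom_def ev_def en_def by blast
  qed
  have "\<exists>A. range A \<subseteq> D \<and> (\<forall>F\<in>{F. finite F \<and> ev F}. C (A ` F)) \<and> (\<forall>F\<in>{F. finite F \<and> en F}. \<not> C (A ` F))"
  proof (rule compact)
    fix T G assume T: "T \<subseteq> {F. finite F \<and> ev F}" "finite T" and G: "G \<subseteq> {F. finite F \<and> en F}" "finite G"
    have "\<forall>F\<in>T. \<exists>k. \<forall>\<rho>. copy F (H k) \<rho> \<longrightarrow> C (A0 ` map \<rho> ` F)"
      using T by (auto simp: ev_def)
    then obtain kT where kT: "\<And>F \<rho>. F \<in> T \<Longrightarrow> copy F (H (kT F)) \<rho> \<Longrightarrow> C (A0 ` map \<rho> ` F)"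
      by metis
    have "\<forall>F\<in>G. \<exists>k. \<forall>\<rho>. copy F (H k) \<rho> \<longrightarrow> \<not> C (A0 ` map \<rho> ` F)"
      using G by (auto simp: en_def)
    then obtain kG where kG: "\<And>F \<rho>. F \<in> G \<Longrightarrow> copy F (H (kG F)) \<rho> \<Longrightarrow> \<not> C (A0 ` map \<rho> ` F)"
      by metis
    obtain k where k: "\<forall>m\<in>kT ` T \<union> kG ` G. m \<le> k"
      using finite_nat_set_iff_bounded_le[of "kT ` T \<union> kG ` G"] T(2) G(2) by auto
    let ?L = "\<Union>F\<in>T \<union> G. labels F"
    have "finite ?L" using T G by (auto intro!: finite_labels)
    \<comment> \<open>One map into a sufficiently late \<open>H k\<close> copies all the finitely
      many families at once.\<close>
    then obtain \<rho> where \<rho>: "strict_mono_on ?L \<rho>" "range \<rho> \<subseteq> H k"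
      using ex_strict_mono_on_into_infinite[OF _ H(1)] by blast
    have cp: "copy F (H m) \<rho>" if "F \<in> T \<union> G" "m \<le> k" for F m
      unfolding copy_def
      using that \<rho> H_mono[OF that(2)] by (auto intro: monotone_on_subset)
    have "C (A0 ` map \<rho> ` F)" if "F \<in> T" for F
      using that k by (auto intro!: kT cp)
    moreover have "\<not> C (A0 ` map \<rho> ` F)" if "F \<in> G" for F
      using that k by (intro kG cp) auto
    ultimately show "\<exists>A. range A \<subseteq> D \<and> (\<forall>F\<in>T. C (A ` F)) \<and> (\<forall>F\<in>G. \<not> C (A ` F))"
      using D by (intro exI[of _ "A0 \<circ> map \<rho>"]) (auto simp: image_image)
  qed auto
  then obtain A where A: "range A \<subseteq> D" "\<And>F. finite F \<Longrightarrow> ev F \<Longrightarrow> C (A ` F)"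
    "\<And>F. finite F \<Longrightarrow> en F \<Longrightarrow> \<not> C (A ` F)" by blast
  show ?thesis
  proof (intro exI[of _ A] conjI allI impI)
    show "range A \<subseteq> D" by fact
    show "C (A ` {t. prefix t s})" for s
    proof (rule A(2))
      have pre: "{t. prefix t s} = set (prefixes s)" by auto
      show "finite {t. prefix t s}" by (simp add: pre)
      have "C (A0 ` map \<rho> ` {t. prefix t s})" for \<rho>
        by (rule C_mono[OF P[of "map \<rho> s"]]) (auto intro: map_mono_prefix)
      then show "ev {t. prefix t s}" by (simp add: ev_def)
    qed
    show "\<not> C {A (u @ [x]), A (u @ [y] @ w)}" if "x < y" for u x y w
    proof -
      have "\<not> C (A ` {u @ [x], u @ [y] @ w})"
      proof (rule A(3))
        have "\<not> C (A0 ` map \<rho> ` {u @ [x], u @ [y] @ w})" if "copy {u @ [x], u @ [y] @ w} (H 0) \<rho>" for \<rho>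
        proof -
          have "\<rho> x < \<rho> y" using that \<open>x < y\<close> by (auto simp: copy_def labels_def strict_mono_on_def)
          then show ?thesis using I[of "\<rho> x" "\<rho> y" "map \<rho> u" "map \<rho> w"] by simp
        qed
        then show "en {u @ [x], u @ [y] @ w}" unfolding en_def by blast
      qed simp
      then show ?thesis by simp
    qed
    show "C (A ` map \<pi> ` F)" if F: "finite F" and \<pi>: "strict_mono_on (labels F) \<pi>" and "C (A ` F)" for F \<pi>
    proof -
      have "ev F" using that ev_or_en A(3) by blast
      then obtain k where k: "\<And>\<rho>. copy F (H k) \<rho> \<Longrightarrow> C (A0 ` map \<rho> ` F)" by (auto simp: ev_def)
      have lab: "labels (map \<pi> ` F) = \<pi> ` labels F" by (auto simp: labels_def)
      have "C (A0 ` map \<rho> ` map \<pi> ` F)" if "copy (map \<pi> ` F) (H k) \<rho>" for \<rho>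
      proof -
        \<comment> \<open>A copy of the relabelled family is a copy of \<open>F\<close> along the
          composed map, so the same stage \<open>k\<close> witnesses \<open>ev\<close> for
          both.\<close>
        have "copy F (H k) (\<rho> \<circ> \<pi>)"
          using that \<pi> unfolding copy_def lab by (auto simp: strict_mono_on_def)
        from k[OF this] show ?thesis by (simp add: image_image)
      qed
      then have "ev (map \<pi> ` F)" unfolding ev_def by blast
      then show ?thesis using F by (intro A(2)) auto
    qed
  qed
qed

end

section \<open>Configurations of chains\<close>

definition grid :: "rat \<Rightarrow> rat \<Rightarrow> nat \<Rightarrow> rat list" where
  "grid lo hi c = map (\<lambda>i. lo + (hi - lo) * (of_nat (Suc i) / of_nat (Suc c))) [0..<c]"

lemma length_grid [simp]: "length (grid lo hi c) = c"
  by (simp add: grid_def)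

lemma sorted_grid: "lo < hi \<Longrightarrow> sorted_wrt (<) (grid lo hi c)"
  unfolding grid_def sorted_wrt_map
  by (rule sorted_wrt_mono_rel[OF _ sorted_wrt_upt])
    (auto intro!: mult_strict_left_mono divide_strict_right_mono)

lemma set_grid: "lo < hi \<Longrightarrow> set (grid lo hi c) \<subseteq> {lo<..<hi}"
proof
  fix r assume lh: "lo < hi" and "r \<in> set (grid lo hi c)"
  then obtain i where i: "i < c" "r = lo + (hi - lo) * (of_nat (Suc i) / of_nat (Suc c))"
    unfolding grid_def by auto
  define q :: rat where "q = of_nat (Suc i) / of_nat (Suc c)"
  have "of_nat (Suc i) < (of_nat (Suc c) :: rat)" "0 < (of_nat (Suc i) :: rat)"
    using i(1) of_nat_less_iff[of "Suc i" "Suc c"] of_nat_0_less_iff[of "Suc i"] by blast+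
  then have q: "0 < q" "q < 1" unfolding q_def by (auto simp del: of_nat_Suc)
  have "(hi - lo) * q < (hi - lo) * 1" "0 < (hi - lo) * q"
    using q lh by (intro mult_strict_left_mono mult_pos_pos; simp)+
  then show "r \<in> {lo<..<hi}" using i(2) unfolding q_def[symmetric] by simp
qed

text \<open>The labels along the path to a node \<open>\<eta>\<close> of the binary tree, the node at depth \<open>i\<close>
  contributing \<open>f i\<close> of them. Each interval is cut in three: labels of the current node,
  then those of the left subtree, then those of the right subtree.\<close>
fun path :: "rat \<Rightarrow> rat \<Rightarrow> (nat \<Rightarrow> nat) \<Rightarrow> bool list \<Rightarrow> rat list" where
  "path lo hi f [] = grid lo ((2 * lo + hi) / 3) (f 0)"
| "path lo hi f (b # \<eta>) = grid lo ((2 * lo + hi) / 3) (f 0) @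
     (if b then path ((lo + 2 * hi) / 3) hi (\<lambda>i. f (Suc i)) \<eta>
      else path ((2 * lo + hi) / 3) ((lo + 2 * hi) / 3) (\<lambda>i. f (Suc i)) \<eta>)"

lemma thirds:
  fixes lo hi :: rat
  assumes "lo < hi"
  shows "lo < (2 * lo + hi) / 3" "(2 * lo + hi) / 3 < (lo + 2 * hi) / 3" "(lo + 2 * hi) / 3 < hi"
  using assms by (simp_all add: field_simps)

lemma set_path: "lo < hi \<Longrightarrow> set (path lo hi f \<eta>) \<subseteq> {lo<..<hi}"
proof (induction lo hi f \<eta> rule: path.induct)
  case (1 lo hi f)
  then show ?case using set_grid[OF thirds(1)[OF 1]] thirds[OF 1] by fastforce
next
  case (2 lo hi f b \<eta>)
  note t = thirds[OF 2(3)]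
  have "set (grid lo ((2 * lo + hi) / 3) (f 0)) \<subseteq> {lo<..<hi}"
    using set_grid[OF t(1)] t by fastforce
  moreover have "b \<Longrightarrow> set (path ((lo + 2 * hi) / 3) hi (\<lambda>i. f (Suc i)) \<eta>) \<subseteq> {lo<..<hi}"
    using 2(1)[OF _ t(3)] t by fastforce
  moreover have "\<not> b \<Longrightarrow> set (path ((2 * lo + hi) / 3) ((lo + 2 * hi) / 3) (\<lambda>i. f (Suc i)) \<eta>) \<subseteq> {lo<..<hi}"
    using 2(2)[OF _ t(2)] t by fastforce
  ultimately show ?case by auto
qed

lemma sorted_path: "lo < hi \<Longrightarrow> sorted_wrt (<) (path lo hi f \<eta>)"
proof (induction lo hi f \<eta> rule: path.induct)
  case (1 lo hi f)
  then show ?case using sorted_grid[OF thirds(1)[OF 1]] by simp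
next
  case (2 lo hi f b \<eta>)
  note t = thirds[OF 2(3)]
  have g: "sorted_wrt (<) (grid lo ((2 * lo + hi) / 3) (f 0))"
    "set (grid lo ((2 * lo + hi) / 3) (f 0)) \<subseteq> {lo<..<(2 * lo + hi) / 3}"
    using sorted_grid[OF t(1)] set_grid[OF t(1)] by auto
  show ?case
  proof (cases b)
    case True
    then show ?thesis using g 2(1)[OF True t(3)] set_path[OF t(3)] t
      by (fastforce simp: sorted_wrt_append)
  next
    case False
    then show ?thesis using g 2(2)[OF False t(2)] set_path[OF t(2)] t
      by (fastforce simp: sorted_wrt_append)
  qed
qed

lemma length_path: "length (path lo hi f \<eta>) = (\<Sum>i\<le>length \<eta>. f i)"
  by (induction lo hi f \<eta> rule: path.induct) (simp_all add: sum.atMost_Suc_shift del: sum.atMost_Suc)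

lemma prefix_path: "prefix \<sigma> \<eta> \<Longrightarrow> prefix (path lo hi f \<sigma>) (path lo hi f \<eta>)"
proof (induction \<sigma> arbitrary: lo hi f \<eta>)
  case Nil
  then show ?case by (cases \<eta>) auto
next
  case (Cons b \<sigma>)
  then obtain \<eta>' where "\<eta> = b # \<eta>'" "prefix \<sigma> \<eta>'" by (auto elim!: prefixE)
  then show ?case using Cons.IH by simp
qed

text \<open>At the vertex \<open>\<sigma>\<close>, \<open>c\<close> and \<open>m\<close> are the
  ends of the middle third of its interval: all earlier labels lie below \<open>c\<close>, the left
  continuation between \<open>c\<close> and \<open>m\<close>, and the right one above
  \<open>m\<close>. This is the separation that a branching node of \<open>conf\<close>
  demands.\<close>

lemma path_split:
  assumes "lo < hi"
  shows "\<exists>x x' c m. lo < c \<and> c < m \<and> m < hi \<and>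
    path lo hi f (\<sigma> @ False # \<eta>) = path lo hi f \<sigma> @ x \<and>
    path lo hi f (\<sigma> @ True # \<nu>) = path lo hi f \<sigma> @ x' \<and>
    set (path lo hi f \<sigma>) \<subseteq> {lo<..<c} \<and> set x \<subseteq> {c<..<m} \<and> set x' \<subseteq> {m<..<hi}"
  using assms
proof (induction \<sigma> arbitrary: lo hi f)
  case Nil
  note t = thirds[OF Nil]
  show ?case
    apply (rule exI[of _ "path ((2 * lo + hi) / 3) ((lo + 2 * hi) / 3) (\<lambda>i. f (Suc i)) \<eta>"])
    apply (rule exI[of _ "path ((lo + 2 * hi) / 3) hi (\<lambda>i. f (Suc i)) \<nu>"])
    apply (rule exI[of _ "(2 * lo + hi) / 3"], rule exI[of _ "(lo + 2 * hi) / 3"])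
    using t set_grid[OF t(1)] set_path[OF t(2)] set_path[OF t(3)] by auto
next
  case (Cons b \<sigma>)
  note t = thirds[OF Cons.prems]
  define lo' hi' where "lo' = (if b then (lo + 2 * hi) / 3 else (2 * lo + hi) / 3)"
    and "hi' = (if b then hi else (lo + 2 * hi) / 3)"
  have lh: "(2 * lo + hi) / 3 \<le> lo'" "lo' < hi'" "hi' \<le> hi" "lo < lo'"
    using t by (auto simp: lo'_def hi'_def)
  have p: "path lo hi f (b # \<tau>) = grid lo ((2 * lo + hi) / 3) (f 0) @ path lo' hi' (\<lambda>i. f (Suc i)) \<tau>" for \<tau>
    by (simp add: lo'_def hi'_def)
  obtain x x' c m where *: "lo' < c" "c < m" "m < hi'"
    "path lo' hi' (\<lambda>i. f (Suc i)) (\<sigma> @ False # \<eta>) = path lo' hi' (\<lambda>i. f (Suc i)) \<sigma> @ x"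
    "path lo' hi' (\<lambda>i. f (Suc i)) (\<sigma> @ True # \<nu>) = path lo' hi' (\<lambda>i. f (Suc i)) \<sigma> @ x'"
    "set (path lo' hi' (\<lambda>i. f (Suc i)) \<sigma>) \<subseteq> {lo'<..<c}" "set x \<subseteq> {c<..<m}" "set x' \<subseteq> {m<..<hi'}"
    using Cons.IH[OF lh(2), of "\<lambda>i. f (Suc i)"] by blast
  have "set (grid lo ((2 * lo + hi) / 3) (f 0)) \<subseteq> {lo<..<c}"
    using set_grid[OF t(1)] lh * by fastforce
  moreover have "{lo'<..<c} \<subseteq> {lo<..<c}" "{m<..<hi'} \<subseteq> {m<..<hi}" using lh by auto
  ultimately show ?case
    using * lh by (intro exI[of _ x] exI[of _ x'] exI[of _ c] exI[of _ m]) (auto simp only: append_Cons p set_append append_assoc)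
qed

text \<open>Families of nodes of \<open>rat\<close>-labelled trees above the stem \<open>u\<close>: \<open>conf 0\<close> is a chain of \<open>M\<close>
  nodes, at arbitrary levels, and \<open>conf (Suc n)\<close> is one node with two copies of \<open>conf n\<close>
  above it, all the labels of the left copy preceding those of the right copy.\<close>
fun conf :: "nat \<Rightarrow> nat \<Rightarrow> rat list \<Rightarrow> rat \<Rightarrow> rat \<Rightarrow> rat list set \<Rightarrow> bool" where
  "conf 0 M u lo hi F \<longleftrightarrow> (\<exists>x J. sorted_wrt (<) x \<and> set x \<subseteq> {lo<..<hi} \<and> J \<subseteq> {1..length x} \<and>
     card J = M \<and> F = (\<lambda>j. u @ take j x) ` J)"
| "conf (Suc n) M u lo hi F \<longleftrightarrow> (\<exists>y i c m F1 F2. sorted_wrt (<) y \<and> set y \<subseteq> {lo<..<c} \<and>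
     1 \<le> i \<and> i \<le> length y \<and> lo < c \<and> c < m \<and> m < hi \<and>
     conf n M (u @ y) c m F1 \<and> conf n M (u @ y) m hi F2 \<and> F = insert (u @ take i y) (F1 \<union> F2))"

lemma conf_finite: "conf n M u lo hi F \<Longrightarrow> finite F"
proof (induction n arbitrary: u lo hi F)
  case 0
  then show ?case by (auto intro: finite_subset)
qed auto

lemma conf_labels: "conf n M u lo hi F \<Longrightarrow> labels F \<subseteq> set u \<union> {lo<..<hi}"
proof (induction n arbitrary: u lo hi F)
  case 0
  then show ?case by (fastforce simp: labels_def dest: in_set_takeD)
next
  case (Suc n)
  then obtain y i c m F1 F2 where *: "set y \<subseteq> {lo<..<c}" "lo < c" "c < m" "m < hi"
    "conf n M (u @ y) c m F1" "conf n M (u @ y) m hi F2" "F = insert (u @ take i y) (F1 \<union> F2)"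
    by auto
  have "labels F = set u \<union> set (take i y) \<union> labels F1 \<union> labels F2"
    unfolding * by (auto simp: labels_def)
  moreover have "set (take i y) \<subseteq> set y" by (rule set_take_subset)
  moreover have "labels F1 \<subseteq> set u \<union> set y \<union> {c<..<m}" "labels F2 \<subseteq> set u \<union> set y \<union> {m<..<hi}"
    using Suc.IH[OF *(5)] Suc.IH[OF *(6)] by auto
  moreover have "{c<..<m} \<subseteq> {lo<..<hi}" "{m<..<hi} \<subseteq> {lo<..<hi}" "{lo<..<c} \<subseteq> {lo<..<hi}"
    using * by auto
  ultimately show ?case using *(1) by blast
qed

text \<open>The bound depends on \<open>n\<close> and \<open>M\<close> alone, because the levels of
  the nodes vary freely but their number does not.\<close>

lemma conf_card_bounded: "\<exists>B. \<forall>u lo hi F. conf n M u lo hi F \<longrightarrow> card F \<le> B"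
proof (induction n)
  case 0
  have "card F \<le> M" if "conf 0 M u lo hi F" for u lo hi F
    using that by (auto intro!: card_image_le intro: finite_subset)
  then show ?case by blast
next
  case (Suc n)
  then obtain B where B: "\<And>u lo hi F. conf n M u lo hi F \<Longrightarrow> card F \<le> B" by blast
  have "card F \<le> Suc (B + B)" if "conf (Suc n) M u lo hi F" for u lo hi F
  proof -
    from that obtain y i c m F1 F2 where *: "conf n M (u @ y) c m F1" "conf n M (u @ y) m hi F2"
      "F = insert (u @ take i y) (F1 \<union> F2)" by auto
    have "card F \<le> Suc (card (F1 \<union> F2))" unfolding *(3) by (rule card_insert_le_m1) auto
    also have "card (F1 \<union> F2) \<le> card F1 + card F2" by (rule card_Un_le)
    finally show ?thesis using B[OF *(1)] B[OF *(2)] by linarith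
  qed
  then show ?case by blast
qed

text \<open>Each chain is thinned to \<open>M\<close> of its nodes. The label sequences stay as they
  are, which is possible because a chain may skip levels.\<close>

lemma conf_mono: "M \<le> M' \<Longrightarrow> conf n M' u lo hi F \<Longrightarrow> \<exists>F'\<subseteq>F. conf n M u lo hi F'"
proof (induction n arbitrary: u lo hi F)
  case 0
  then obtain x J where *: "sorted_wrt (<) x" "set x \<subseteq> {lo<..<hi}" "J \<subseteq> {1..length x}"
     "card J = M'" "F = (\<lambda>j. u @ take j x) ` J" by auto
  obtain J' where "J' \<subseteq> J" "card J' = M" using 0(1) *(4) by (metis obtain_subset_with_card_n)
  then have "conf 0 M u lo hi ((\<lambda>j. u @ take j x) ` J')"
    using *(1-3) unfolding conf.simps by (intro exI[of _ x] exI[of _ J']) auto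
  then show ?case using \<open>J' \<subseteq> J\<close> *(5) by (intro exI[of _ "(\<lambda>j. u @ take j x) ` J'"]) auto
next
  case (Suc n)
  then obtain y i c m F1 F2 where *: "sorted_wrt (<) y" "set y \<subseteq> {lo<..<c}"
     "1 \<le> i" "i \<le> length y" "lo < c" "c < m" "m < hi"
    "conf n M' (u @ y) c m F1" "conf n M' (u @ y) m hi F2" "F = insert (u @ take i y) (F1 \<union> F2)"
    by auto
  obtain F1' F2' where "F1' \<subseteq> F1" "conf n M (u @ y) c m F1'" "F2' \<subseteq> F2" "conf n M (u @ y) m hi F2'"
    using Suc.IH[OF Suc.prems(1) *(8)] Suc.IH[OF Suc.prems(1) *(9)] by blast
  moreover from this have "conf (Suc n) M u lo hi (insert (u @ take i y) (F1' \<union> F2'))"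
    using *(1-7) unfolding conf.simps(2) by metis
  ultimately show ?case using *(10) by (meson Un_mono insert_mono)
qed

text \<open>\<open>K M W u lo hi\<close> says that \<open>W\<close> is an allowed context for a subconfiguration with chains of
  length \<open>M\<close>, stem \<open>u\<close> and labels between \<open>lo\<close> and \<open>hi\<close>. The bound on \<open>card W\<close> keeps the number
  of conjuncts independent of the depth of the SOP2 trees built from \<open>K\<close>.\<close>
definition admissible :: "(nat \<Rightarrow> rat list set \<Rightarrow> rat list \<Rightarrow> rat \<Rightarrow> rat \<Rightarrow> bool) \<Rightarrow> bool" where
  "admissible K \<longleftrightarrow>
     (\<forall>M W u lo hi. K M W u lo hi \<longrightarrow> finite W \<and> lo < hi \<and> (labels W \<union> set u) \<inter> {lo<..<hi} = {}) \<and>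
     (\<forall>M M' W u lo hi. M \<le> M' \<longrightarrow> K M' W u lo hi \<longrightarrow> (\<exists>W'\<subseteq>W. K M W' u lo hi)) \<and>
     (\<forall>M. \<exists>B. \<forall>W u lo hi. K M W u lo hi \<longrightarrow> card W \<le> B)"

section \<open>Splitting chains\<close>

text \<open>A set with at most \<open>n + 1\<close> elements is padded by repetition, so that each
  vertex of an SOP2 tree carries exactly \<open>n + 1\<close> tuples.\<close>

lemma finite_image_of_initial_segment:
  assumes "finite X" "X \<noteq> {}" "card X \<le> Suc n"
  shows "\<exists>t :: nat \<Rightarrow> 'a. t ` {..n} = X"
proof -
  obtain xs where xs: "set xs = X" "length xs = card X"
    using assms(1) by (metis distinct_card finite_distinct_list)
  define t where "t i = (if i < length xs then xs ! i else hd xs)" for i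
  have "xs \<noteq> []" using xs assms(2) by auto
  then have "t ` {..n} \<subseteq> X" using xs by (auto simp: t_def)
  moreover have "X \<subseteq> t ` {..n}"
  proof
    fix x assume "x \<in> X"
    then obtain i where "i < length xs" "x = xs ! i" using xs by (auto simp: in_set_conv_nth)
    then show "x \<in> t ` {..n}" using xs assms(3) by (intro image_eqI[of _ _ i]) (auto simp: t_def)
  qed
  ultimately show ?thesis by blast
qed

text \<open>Collects the properties obtained in \<open>ex_indiscernible\<close>. The failure of SOP2
  is localized by compactness: with \<open>n + 1\<close> tuples per vertex, trees already fail to
  exist at some finite depth.\<close>

locale indiscernible_tree = compact_consistency D C for D :: "'p set" and C +
  fixes A :: "rat list \<Rightarrow> 'p"
  assumes A_D: "range A \<subseteq> D"
    and branch: "C (A ` {t. prefix t s})"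
    and sibling: "x < y \<Longrightarrow> \<not> C {A (u @ [x]), A (u @ [y] @ w)}"
    and indisc: "finite F \<Longrightarrow> strict_mono_on (labels F) \<pi> \<Longrightarrow> C (A ` F) \<Longrightarrow> C (A ` map \<pi> ` F)"
    and no_SOP2: "\<exists>d. \<forall>t. \<not> SOP2_tree_to n d t"
begin

text \<open>The relabelling taking \<open>x\<close> to \<open>x'\<close> entry by entry and fixing
  everything else is increasing, as all other labels lie outside the interval that contains
  \<open>x\<close> and \<open>x'\<close>.\<close>

lemma chain_transfer:
  assumes W: "finite W" "(labels W \<union> set u) \<inter> {lo<..<hi} = {}"
    and x: "sorted_wrt (<) x" "set x \<subseteq> {lo<..<hi}"
    and x': "sorted_wrt (<) x'" "set x' \<subseteq> {lo<..<hi}" and len: "length x = length x'"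
    and J: "finite J"
    and C: "C (A ` (W \<union> (\<lambda>j. u @ take j x) ` J))"
  shows "C (A ` (W \<union> (\<lambda>j. u @ take j x') ` J))"
proof -
  define \<pi> where "\<pi> r = (if r \<in> set x then x' ! (SOME i. i < length x \<and> x ! i = r) else r)" for r
  have dist: "distinct x" using x(1) strict_sorted_iff by blast
  have \<pi>x: "\<pi> (x ! i) = x' ! i" if i: "i < length x" for i
  proof -
    have "(SOME k. k < length x \<and> x ! k = x ! i) = i"
      by (rule some_equality) (use i dist nth_eq_iff_index_eq in auto)
    then show ?thesis using i by (simp add: \<pi>_def)
  qed
  have "map \<pi> x = x'" using \<pi>x len by (intro nth_equalityI) auto
  then have take: "map \<pi> (take j x) = take j x'" for j by (metis take_map)
  have id: "\<pi> r = r" if "r \<notin> {lo<..<hi}" for r using that x(2) by (auto simp: \<pi>_def)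
  let ?F = "W \<union> (\<lambda>j. u @ take j x) ` J"
  have lab: "labels ?F \<subseteq> (labels W \<union> set u) \<union> set x"
    by (auto simp: labels_def dest: in_set_takeD)
  have out: "r \<in> set x \<or> (r \<notin> {lo<..<hi} \<and> \<pi> r = r)" if "r \<in> labels ?F" for r
    using that lab W(2) id by blast
  have in_x: "\<pi> r \<in> {lo<..<hi}" if r: "r \<in> set x" for r
  proof -
    obtain i where "i < length x" "r = x ! i" using r by (auto simp: in_set_conv_nth)
    then have "\<pi> r \<in> set x'" using \<pi>x len by simp
    then show ?thesis using x'(2) by blast
  qed
  have "strict_mono_on (labels ?F) \<pi>"
  proof (rule strict_mono_onI)
    fix r s assume r: "r \<in> labels ?F" and s: "s \<in> labels ?F" and rs: "r < s"
    show "\<pi> r < \<pi> s"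
    proof (cases "r \<in> set x \<and> s \<in> set x")
      case True
      then obtain i k where ik: "i < length x" "r = x ! i" "k < length x" "s = x ! k"
        by (auto simp: in_set_conv_nth)
      have "\<not> k \<le> i"
        using ik rs x(1) by (metis le_neq_implies_less less_asym less_irrefl sorted_wrt_iff_nth_less)
      then have "x' ! i < x' ! k" using x'(1) ik len by (simp add: sorted_wrt_iff_nth_less)
      then show ?thesis using ik \<pi>x by simp
    next
      case False
      then show ?thesis
        using out[OF r] out[OF s] in_x[of r] in_x[of s] rs x(2) by fastforce
    qed
  qed
  then have "C (A ` map \<pi> ` ?F)" using W(1) J C by (intro indisc) auto
  moreover have "map \<pi> ` ?F = W \<union> (\<lambda>j. u @ take j x') ` J"
  proof -
    have id': "\<pi> r = r" if "r \<in> labels W \<union> set u" for r using that W(2) id by blast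
    have "map \<pi> w = w" if "w \<in> W" for w
      using that by (intro map_idI id') (auto simp: labels_def)
    moreover have "map \<pi> u = u" by (intro map_idI id') auto
    ultimately show ?thesis by (simp add: image_Un image_image take)
  qed
  ultimately show ?thesis by simp
qed

text \<open>Requiring all chain lengths \<open>M\<close> leaves room to spend a very long chain on
  producing shorter ones.\<close>

definition good :: "(nat \<Rightarrow> rat list set \<Rightarrow> rat list \<Rightarrow> rat \<Rightarrow> rat \<Rightarrow> bool) \<Rightarrow> nat \<Rightarrow> bool" where
  "good K n \<longleftrightarrow> (\<forall>M>0. \<exists>W u lo hi F. K M W u lo hi \<and> conf n M u lo hi F \<and> C (A ` (W \<union> F)))"

text \<open>If all splittings with chains of length \<open>m\<close> were inconsistent, a consistent
  chain with \<open>m\<close> nodes for each depth up to \<open>d\<close>, and one node below them,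
  could be spread over the binary tree of depth \<open>d\<close>. \<open>chain_transfer\<close>
  makes its branches consistent, and incomparable vertices contain a splitting, so this would be a
  forbidden SOP2 tree.\<close>

lemma good_split:
  assumes K: "admissible K" and g: "good K 0"
  shows "good K 1"
proof (rule ccontr)
  assume "\<not> good K 1"
  then obtain m where m: "m > 0" and
    bad: "\<And>W u lo hi F. K m W u lo hi \<Longrightarrow> conf 1 m u lo hi F \<Longrightarrow> \<not> C (A ` (W \<union> F))"
    unfolding good_def by blast
  obtain B where B: "\<And>W u lo hi. K m W u lo hi \<Longrightarrow> card W \<le> B"
    using K unfolding admissible_def by meson
  \<comment> \<open>Each vertex will carry at most \<open>B + 1 + m = n + 1\<close> tuples: the
    context, one common node and a block. This number is fixed before the depth \<open>d\<close> is
    chosen.\<close>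
  define n where "n = B + m"
  obtain d where d: "\<And>t. \<not> SOP2_tree_to n d t" using no_SOP2[of n] by blast
  obtain W0 u lo hi F where W0: "K (Suc (Suc d * m)) W0 u lo hi" "conf 0 (Suc (Suc d * m)) u lo hi F"
    "C (A ` (W0 \<union> F))"
    using g unfolding good_def by blast
  obtain x J where x: "sorted_wrt (<) x" "set x \<subseteq> {lo<..<hi}" and J: "J \<subseteq> {1..length x}"
    "card J = Suc (Suc d * m)" and F: "F = (\<lambda>j. u @ take j x) ` J"
    using W0(2) by auto
  \<comment> \<open>The context comes from a much longer chain. It is shrunk to one allowed for
    \<open>m\<close>, to which the bound \<open>B\<close> and the assumption \<open>bad\<close>
    apply.\<close>
  obtain W where W: "W \<subseteq> W0" "K m W u lo hi"
    using K W0(1) m unfolding admissible_def by (metis le_Suc_eq le_add1 mult_Suc)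
  have W': "finite W" "lo < hi" "(labels W \<union> set u) \<inter> {lo<..<hi} = {}"
    using K[unfolded admissible_def, THEN conjunct1, rule_format, OF W(2)] by simp_all
  have fJ: "finite J" using J(1) finite_subset by blast
  define js where "js = sorted_list_of_set J"
  have js: "sorted_wrt (<) js" "set js = J" "length js = Suc (Suc d * m)"
    using fJ J(2) by (simp_all add: js_def)
  have js_mono: "js ! i < js ! k" if "i < k" "k \<le> Suc d * m" for i k
    using js that by (simp add: sorted_wrt_iff_nth_less)
  have js_mono': "js ! i \<le> js ! k" if "i \<le> k" "k \<le> Suc d * m" for i k
    using js_mono[of i k] that by (cases "i = k") auto
  have jsJ: "js ! i \<in> J" if "i \<le> Suc d * m" for i using js that nth_mem[of i js] by simp
  have idx: "i \<le> Suc k * m \<Longrightarrow> k \<le> d \<Longrightarrow> i \<le> Suc d * m" for i k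
    by (meson Suc_le_mono le_trans mult_le_mono1)
  \<comment> \<open>\<open>bl i\<close> is the \<open>i\<close>-th block of \<open>m\<close> levels
    and \<open>e i\<close> its top level. Position 0 of \<open>js\<close> is left over for the
    common node. The increments \<open>f\<close> give a path to depth \<open>i\<close> exactly
    \<open>e i\<close> labels.\<close>
  define e where "e i = js ! (Suc i * m)" for i
  define f where "f i = (case i of 0 \<Rightarrow> e 0 | Suc k \<Rightarrow> e (Suc k) - e k)" for i
  define bl where "bl i = (!) js ` {i * m<..Suc i * m}" for i
  have f_sum: "(\<Sum>i\<le>k. f i) = e k" if "k \<le> d" for k
    using that
  proof (induction k)
    case (Suc k)
    have "e k \<le> e (Suc k)" unfolding e_def by (intro js_mono' mult_le_mono1) (use Suc.prems in auto)
    then show ?case using Suc by (simp add: f_def)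
  qed (simp add: f_def)
  have bl_J: "bl i \<subseteq> J" and bl_le: "j \<in> bl i \<Longrightarrow> j \<le> e i" if "i \<le> d" for i j
    using that idx[of _ i] jsJ js_mono'[of _ "Suc i * m"] by (auto simp: bl_def e_def)
  have bl_gt: "e i < j" if ik: "i < k" "k \<le> d" and j: "j \<in> bl k" for i j k
  proof -
    obtain r where r: "k * m < r" "r \<le> Suc k * m" "j = js ! r" using j by (auto simp: bl_def)
    have "Suc i * m \<le> k * m" using ik by (intro mult_le_mono1) auto
    then show ?thesis unfolding e_def r(3) using r ik idx by (intro js_mono) auto
  qed
  have bl_card: "card (bl i) = m" if "i \<le> d" for i
  proof -
    have "inj_on ((!) js) {i * m<..Suc i * m}"
    proof (rule inj_on_nth)
      show "distinct js" by (simp add: js_def)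
      show "\<forall>k\<in>{i * m<..Suc i * m}. k < length js" using js(3) idx[OF _ that] by (auto simp: less_Suc_eq_le)
    qed
    then show ?thesis by (simp add: bl_def card_image)
  qed
  define p where "p = path lo hi f"
  have p_len: "length (p \<eta>) = e (length \<eta>)" if "length \<eta> \<le> d" for \<eta>
    using that by (simp add: p_def length_path f_sum)
  have p_take: "take j (p \<sigma>) = take j (p \<eta>)" if pre: "prefix \<sigma> \<eta>" and \<sigma>: "length \<sigma> \<le> d" "j \<le> e (length \<sigma>)" for \<sigma> \<eta> j
  proof -
    obtain w where "p \<eta> = p \<sigma> @ w" using prefix_path[OF pre, of lo hi f] unfolding p_def prefix_def by blast
    then show ?thesis using p_len[OF \<sigma>(1)] \<sigma>(2) by simp
  qed
  \<comment> \<open>The lowest chosen level lies within the root's part of every path, so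
    \<open>z\<close> is the same node for all vertices.\<close>
  define j0 where "j0 = js ! 0"
  have j0: "j0 \<in> J" "1 \<le> j0" "\<And>i. i \<le> d \<Longrightarrow> j0 \<le> e i"
    using jsJ[of 0] J(1) js_mono'[of 0] idx by (auto simp: j0_def e_def)
  define z where "z = u @ take j0 (p [])"
  have z: "z = u @ take j0 (p \<eta>)" for \<eta>
    unfolding z_def using p_take[of "[]" \<eta> j0] j0(3)[of 0] by simp
  define S where "S \<eta> = W \<union> insert z ((\<lambda>j. u @ take j (p \<eta>)) ` bl (length \<eta>))" for \<eta>
  have bl_fin: "finite (bl i)" for i by (simp add: bl_def)
  have S_card: "card (A ` S \<eta>) \<le> Suc n" if "length \<eta> \<le> d" for \<eta>
  proof -
    have "card (A ` S \<eta>) \<le> card (S \<eta>)" using W'(1) bl_fin by (intro card_image_le) (simp add: S_def)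
    also have "\<dots> \<le> card W + card (insert z ((\<lambda>j. u @ take j (p \<eta>)) ` bl (length \<eta>)))"
      unfolding S_def by (rule card_Un_le)
    also have "\<dots> \<le> B + Suc (card ((\<lambda>j. u @ take j (p \<eta>)) ` bl (length \<eta>)))"
      using B[OF W(2)] by (intro add_mono card_insert_le_m1) auto
    also have "card ((\<lambda>j. u @ take j (p \<eta>)) ` bl (length \<eta>)) \<le> m"
      using card_image_le[OF bl_fin] bl_card[OF that] by metis
    finally show ?thesis by (simp add: n_def)
  qed
  \<comment> \<open>Vertices beyond depth \<open>d\<close> get a constant junk value in
    \<open>D\<close>.\<close>
  have "\<exists>t. t ` {..n} \<subseteq> D \<and> (length \<eta> \<le> d \<longrightarrow> t ` {..n} = A ` S \<eta>)" for \<eta>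
  proof (cases "length \<eta> \<le> d")
    case True
    have "\<exists>t. t ` {..n} = A ` S \<eta>"
      using S_card[OF True] W'(1) bl_fin by (intro finite_image_of_initial_segment) (auto simp: S_def)
    then show ?thesis using A_D by blast
  next
    case False
    then show ?thesis using A_D by (intro exI[of _ "\<lambda>_. A []"]) auto
  qed
  then obtain t where t: "\<forall>\<eta>. t \<eta> ` {..n} \<subseteq> D" "\<And>\<eta>. length \<eta> \<le> d \<Longrightarrow> t \<eta> ` {..n} = A ` S \<eta>"
    by metis
  have cons: "C (\<Union>\<sigma>\<in>{\<sigma>. prefix \<sigma> \<eta>}. t \<sigma> ` {..n})" if \<eta>: "length \<eta> = d" for \<eta>
  proof -
    have ed: "e d \<le> length x" using jsJ[of "Suc d * m"] J(1) unfolding e_def by fastforce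
    have J_le: "j \<le> e d" if j: "j \<in> J" for j
    proof -
      obtain i where "i < length js" "j = js ! i" using j js(2) by (metis in_set_conv_nth)
      then show ?thesis unfolding e_def using js(3) by (auto intro: js_mono')
    qed
    have "C (A ` (W \<union> (\<lambda>j. u @ take j (p \<eta>)) ` J))"
    proof (rule chain_transfer[OF W'(1,3)])
      \<comment> \<open>Cutting \<open>x\<close> at \<open>e d\<close>, the largest level in
        \<open>J\<close>, gives it the length of the branch without losing a node.\<close>
      show "sorted_wrt (<) (take (e d) x)" using x(1) by (rule sorted_wrt_take)
      show "set (take (e d) x) \<subseteq> {lo<..<hi}" using x(2) set_take_subset by fast
      show "sorted_wrt (<) (p \<eta>)" "set (p \<eta>) \<subseteq> {lo<..<hi}"
        using W'(2) by (simp_all add: p_def sorted_path set_path)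
      show "length (take (e d) x) = length (p \<eta>)" using ed p_len \<eta> by simp
      have eq: "(\<lambda>j. u @ take j (take (e d) x)) ` J = F"
        unfolding F using J_le by (intro image_cong) (auto simp: min_absorb1)
      show "C (A ` (W \<union> (\<lambda>j. u @ take j (take (e d) x)) ` J))"
        unfolding eq by (rule C_mono[OF W0(3)]) (use W(1) in blast)
    qed (rule fJ)
    then show ?thesis
    proof (rule C_mono)
      show "(\<Union>\<sigma>\<in>{\<sigma>. prefix \<sigma> \<eta>}. t \<sigma> ` {..n}) \<subseteq> A ` (W \<union> (\<lambda>j. u @ take j (p \<eta>)) ` J)"
      proof (rule UN_least)
        fix \<sigma> assume "\<sigma> \<in> {\<sigma>. prefix \<sigma> \<eta>}"
        then have pre: "prefix \<sigma> \<eta>" and len: "length \<sigma> \<le> d" using \<eta> by (auto dest: prefix_length_le)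
        have "u @ take j (p \<sigma>) \<in> (\<lambda>j. u @ take j (p \<eta>)) ` J" if "j \<in> bl (length \<sigma>)" for j
          using that bl_J[OF len] bl_le[OF len that] p_take[OF pre len] by auto
        moreover have "z \<in> (\<lambda>j. u @ take j (p \<eta>)) ` J" using z[of \<eta>] j0(1) by auto
        ultimately have "S \<sigma> \<subseteq> W \<union> (\<lambda>j. u @ take j (p \<eta>)) ` J" by (auto simp: S_def)
        then show "t \<sigma> ` {..n} \<subseteq> A ` (W \<union> (\<lambda>j. u @ take j (p \<eta>)) ` J)"
          unfolding t(2)[OF len] by (rule image_mono)
      qed
    qed
  qed
  have incons: "\<not> C (A ` (S (\<sigma> @ False # \<eta>) \<union> S (\<sigma> @ True # \<nu>)))"
    if len: "length (\<sigma> @ False # \<eta>) \<le> d" "length (\<sigma> @ True # \<nu>) \<le> d" for \<sigma> \<eta> \<nu>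
  proof -
    obtain y y' c k where *: "lo < c" "c < k" "k < hi" "p (\<sigma> @ False # \<eta>) = p \<sigma> @ y"
      "p (\<sigma> @ True # \<nu>) = p \<sigma> @ y'" "set (p \<sigma>) \<subseteq> {lo<..<c}" "set y \<subseteq> {c<..<k}" "set y' \<subseteq> {k<..<hi}"
      using path_split[OF W'(2), of f \<sigma> \<eta> \<nu>] unfolding p_def by blast
    have \<sigma>: "length \<sigma> \<le> d" using len by simp
    note e\<sigma> = p_len[OF \<sigma>]
    have part: "conf 0 m (u @ p \<sigma>) a b ((\<lambda>j. u @ take j (p \<tau>)) ` bl (length \<tau>))"
      if \<tau>: "length \<tau> \<le> d" "length \<sigma> < length \<tau>" "p \<tau> = p \<sigma> @ v" "set v \<subseteq> {a<..<b}" for \<tau> v a b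
    proof -
      \<comment> \<open>Levels are counted anew from the end of the stem \<open>p \<sigma>\<close>.
        By \<open>bl_gt\<close> the whole block lies above that stem.\<close>
      let ?J = "(\<lambda>j. j - e (length \<sigma>)) ` bl (length \<tau>)"
      have gt: "e (length \<sigma>) < j" if "j \<in> bl (length \<tau>)" for j using bl_gt \<tau>(1,2) that by blast
      have "sorted_wrt (<) (p \<tau>)" unfolding p_def using W'(2) by (rule sorted_path)
      then have "sorted_wrt (<) v" using \<tau>(3) by (simp add: sorted_wrt_append)
      moreover have "length v = e (length \<tau>) - e (length \<sigma>)" using p_len[OF \<tau>(1)] e\<sigma> \<tau>(3) by simp
      then have "?J \<subseteq> {1..length v}" using gt bl_le[OF \<tau>(1)] by (auto simp: Suc_le_eq diff_le_mono)
      moreover have "card ?J = m"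
      proof -
        have "inj_on (\<lambda>j. j - e (length \<sigma>)) (bl (length \<tau>))"
          using gt by (intro inj_on_diff_nat) (auto intro: less_imp_le)
        then show ?thesis using bl_card[OF \<tau>(1)] by (simp add: card_image)
      qed
      moreover have "(\<lambda>j. u @ take j (p \<tau>)) ` bl (length \<tau>) = (\<lambda>j. (u @ p \<sigma>) @ take j v) ` ?J"
        unfolding image_image using gt e\<sigma> \<tau>(3) by (intro image_cong) (auto intro: less_imp_le)
      ultimately show ?thesis using \<tau>(4) unfolding conf.simps by blast
    qed
    have "sorted_wrt (<) (p \<sigma>)" unfolding p_def using W'(2) by (rule sorted_path)
    moreover have "j0 \<le> length (p \<sigma>)" using j0(3) \<sigma> e\<sigma> by simp
    \<comment> \<open>The common node \<open>z\<close> is the branching node, with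
      \<open>p \<sigma>\<close> as stem, and the two blocks are the chains above it.\<close>
    ultimately have "conf 1 m u lo hi (insert (u @ take j0 (p \<sigma>))
        ((\<lambda>j. u @ take j (p (\<sigma> @ False # \<eta>))) ` bl (length (\<sigma> @ False # \<eta>)) \<union>
         (\<lambda>j. u @ take j (p (\<sigma> @ True # \<nu>))) ` bl (length (\<sigma> @ True # \<nu>))))" (is "conf 1 m u lo hi ?F")
      unfolding One_nat_def conf.simps(2)
      using * j0(2) part[OF len(1) _ *(4,7)] part[OF len(2) _ *(5,8)]
      by (intro exI[of _ "p \<sigma>"] exI[of _ j0] exI[of _ c] exI[of _ k]) auto
    then have b: "\<not> C (A ` (W \<union> ?F))" by (rule bad[OF W(2)])
    have eq: "W \<union> ?F = S (\<sigma> @ False # \<eta>) \<union> S (\<sigma> @ True # \<nu>)"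
      unfolding S_def z[of \<sigma>, symmetric] by auto
    show ?thesis using b unfolding eq .
  qed
  have "\<not> C (t \<eta> ` {..n} \<union> t \<nu> ` {..n})" if len: "length \<eta> \<le> d" "length \<nu> \<le> d" and par: "\<eta> \<parallel> \<nu>" for \<eta> \<nu>
  proof -
    obtain \<sigma> b \<eta>' c \<nu>' where dec: "b \<noteq> c" "\<eta> = \<sigma> @ b # \<eta>'" "\<nu> = \<sigma> @ c # \<nu>'"
      using parallel_decomp[OF par] by blast
    have "\<not> C (A ` (S \<eta> \<union> S \<nu>))"
    proof (cases b)
      case True
      then show ?thesis using incons[of \<sigma> \<nu>' \<eta>'] dec len by (simp add: Un_commute)
    next
      case False
      then show ?thesis using incons[of \<sigma> \<eta>' \<nu>'] dec len by simp
    qed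
    then show ?thesis using t(2) len by (simp add: image_Un)
  qed
  then have "SOP2_tree_to n d t" unfolding SOP2_tree_to_def using t(1) cons by blast
  then show False using d by blast
qed

end

section \<open>Antichain trees\<close>

text \<open>Choose the branching nodes, and at the leaves any node of each chain. Stems and the two
  copies use disjoint label ranges, and labels along a node are distinct, so a last label reappears
  only further up the same branch. On an antichain the last labels can therefore be changed without
  touching the rest.\<close>

lemma conf_skeleton:
  assumes "conf n M u lo hi F" "M > 0" "set u \<inter> {lo<..<hi} = {}"
  shows "\<exists>z :: bool list \<Rightarrow> rat list. (\<forall>\<eta>. length \<eta> \<le> n \<longrightarrow> z \<eta> \<in> F \<and> strict_prefix u (z \<eta>) \<and> last (z \<eta>) \<in> {lo<..<hi}) \<and>
    (\<forall>\<eta> \<nu>. length \<eta> \<le> n \<longrightarrow> length \<nu> \<le> n \<longrightarrow> strict_prefix \<eta> \<nu> \<longrightarrow> strict_prefix (z \<eta>) (z \<nu>)) \<and>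
    (\<forall>\<eta> \<nu>. length \<eta> \<le> n \<longrightarrow> length \<nu> \<le> n \<longrightarrow> last (z \<nu>) \<in> set (butlast (z \<eta>)) \<longrightarrow> strict_prefix \<nu> \<eta>)"
    (is "\<exists>z. ?A n u lo hi F z \<and> ?B n z \<and> ?C n z")
  using assms
proof (induction n arbitrary: u lo hi F)
  have node: "strict_prefix u (u @ take i y) \<and> last (u @ take i y) \<in> set y \<and>
      last (u @ take i y) \<notin> set (butlast (u @ take i y))"
    if "sorted_wrt (<) y" "1 \<le> i" "i \<le> length y" "set u \<inter> set y = {}" for u y :: "rat list" and i
  proof -
    let ?t = "take i y"
    have ne: "?t \<noteq> []" using that by auto
    have "distinct y" using that(1) strict_sorted_iff by blast
    then have "distinct (butlast ?t @ [last ?t])" using ne by simp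
    then have "last ?t \<notin> set (butlast ?t)" by simp
    moreover have "last ?t \<in> set y" using ne last_in_set in_set_takeD by fast
    ultimately show ?thesis using that(4) ne by (auto simp: butlast_append strict_prefix_def)
  qed
  {
    case 0
    then obtain x J where *: "sorted_wrt (<) x" "set x \<subseteq> {lo<..<hi}" "J \<subseteq> {1..length x}"
       "card J = M" "F = (\<lambda>j. u @ take j x) ` J" by auto
    obtain j where j: "j \<in> J" using *(4) 0(2) by fastforce
    have "strict_prefix u (u @ take j x) \<and> last (u @ take j x) \<in> set x \<and>
      last (u @ take j x) \<notin> set (butlast (u @ take j x))"
      by (rule node[OF *(1)]) (use j *(2,3) 0(3) in auto)
    then show ?case using j * by (intro exI[of _ "\<lambda>_. u @ take j x"]) auto
  next
    case (Suc n)
    then obtain y i c m F1 F2 where *: "sorted_wrt (<) y" "set y \<subseteq> {lo<..<c}"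
       "1 \<le> i" "i \<le> length y" "lo < c" "c < m" "m < hi"
      "conf n M (u @ y) c m F1" "conf n M (u @ y) m hi F2" "F = insert (u @ take i y) (F1 \<union> F2)"
      by auto
    have uy: "set u \<inter> set y = {}" "set (u @ y) \<inter> {c<..<m} = {}" "set (u @ y) \<inter> {m<..<hi} = {}"
      using *(2,5,6,7) Suc.prems(3) by fastforce+
    obtain z1 where z1: "?A n (u @ y) c m F1 z1" "?B n z1" "?C n z1"
      using Suc.IH[OF *(8) Suc.prems(2) uy(2)] by auto
    obtain z2 where z2: "?A n (u @ y) m hi F2 z2" "?B n z2" "?C n z2"
      using Suc.IH[OF *(9) Suc.prems(2) uy(3)] by auto
    define r where "r = u @ take i y"
    have r: "strict_prefix u r" "last r \<in> set y" "last r \<notin> set (butlast r)"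
      using node[OF *(1,3,4) uy(1)] by (auto simp: r_def)
    have r_le: "prefix r (u @ y)" "set r \<subseteq> set (u @ y)"
      by (auto simp: r_def take_is_prefix dest: in_set_takeD)
    define z where "z \<eta> = (case \<eta> of [] \<Rightarrow> r | b # \<eta>' \<Rightarrow> (if b then z2 \<eta>' else z1 \<eta>'))" for \<eta>
    have [simp]: "z [] = r" "z (True # \<eta>) = z2 \<eta>" "z (False # \<eta>) = z1 \<eta>" for \<eta>
      by (simp_all add: z_def)
    have z1F: "z1 \<eta> \<in> F1" "strict_prefix (u @ y) (z1 \<eta>)" "c < last (z1 \<eta>)" "last (z1 \<eta>) < m"
        "set (z1 \<eta>) \<subseteq> set (u @ y) \<union> {c<..<m}" if "length \<eta> \<le> n" for \<eta>
      using z1(1) conf_labels[OF *(8)] that by (auto simp: labels_def)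
    have z2F: "z2 \<eta> \<in> F2" "strict_prefix (u @ y) (z2 \<eta>)" "m < last (z2 \<eta>)" "last (z2 \<eta>) < hi"
        "set (z2 \<eta>) \<subseteq> set (u @ y) \<union> {m<..<hi}" if "length \<eta> \<le> n" for \<eta>
      using z2(1) conf_labels[OF *(9)] that by (auto simp: labels_def)
    have "?A (Suc n) u lo hi F z"
    proof (intro allI impI)
      fix \<eta> :: "bool list" assume len: "length \<eta> \<le> Suc n"
      have u: "prefix u (u @ y)" by simp
      show "z \<eta> \<in> F \<and> strict_prefix u (z \<eta>) \<and> last (z \<eta>) \<in> {lo<..<hi}"
      proof (cases \<eta>)
        case Nil
        then show ?thesis using r *(2,5,6,7,10) by (auto simp: r_def[symmetric])
      next
        case (Cons b \<eta>')
        then have "length \<eta>' \<le> n" using len by simp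
        from z1F[OF this] z2F[OF this] show ?thesis
          using Cons *(5,6,7,10) prefix_order.le_less_trans[OF u] by (cases b) auto
      qed
    qed
    moreover have "?B (Suc n) z"
    proof (intro allI impI)
      fix \<eta> \<nu> :: "bool list" assume len: "length \<eta> \<le> Suc n" "length \<nu> \<le> Suc n" and pre: "strict_prefix \<eta> \<nu>"
      from pre obtain b \<nu>' where \<nu>: "\<nu> = b # \<nu>'" by (cases \<nu>) auto
      then have l: "length \<nu>' \<le> n" using len by simp
      show "strict_prefix (z \<eta>) (z \<nu>)"
      proof (cases \<eta>)
        case Nil
        then show ?thesis using \<nu> z1F(2)[OF l] z2F(2)[OF l] prefix_order.le_less_trans[OF r_le(1)]
          by (cases b) auto
      next
        case (Cons b' \<eta>')
        then show ?thesis using \<nu> pre len z1(2) z2(2) by (cases b) auto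
      qed
    qed
    moreover have "?C (Suc n) z"
    proof (intro allI impI)
      fix \<eta> \<nu> :: "bool list" assume len: "length \<eta> \<le> Suc n" "length \<nu> \<le> Suc n"
        and mem: "last (z \<nu>) \<in> set (butlast (z \<eta>))"
      have mem': "last (z \<nu>) \<in> set (z \<eta>)" using mem by (rule in_set_butlastD)
      show "strict_prefix \<nu> \<eta>"
      proof (cases \<nu>)
        case Nil
        then show ?thesis using mem r(3) by (cases \<eta>) auto
      next
        case (Cons b \<nu>')
        then have l: "length \<nu>' \<le> n" using len by simp
        show ?thesis
        proof (cases \<eta>)
          case Nil
          then have "last (z \<nu>) \<in> set (u @ y)" using mem' r_le by auto
          then show ?thesis using Cons z1F(3,4)[OF l] z2F(3,4)[OF l] uy by (cases b) auto
        next
          case (Cons b' \<eta>')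
          then have l': "length \<eta>' \<le> n" using len by simp
          show ?thesis
          proof (cases "b = b'")
            case True
            then show ?thesis
              using mem z1(3) z2(3) l l' \<open>\<nu> = b # \<nu>'\<close> \<open>\<eta> = b' # \<eta>'\<close> by (cases b) auto
          next
            case False
            \<comment> \<open>The last label of \<open>z \<nu>\<close> lies in the interval of one
              copy, whereas \<open>z \<eta>\<close> has labels in the common stem and in the
              interval of the other.\<close>
            then have False
              using mem' z1F(3-5)[OF l] z2F(3-5)[OF l] z1F(3-5)[OF l'] z2F(3-5)[OF l'] uy
                \<open>\<nu> = b # \<nu>'\<close> \<open>\<eta> = b' # \<eta>'\<close> *(5-7) by (cases b; cases b') fastforce+
            then show ?thesis ..
          qed
        qed
      qed
    qed
    ultimately show ?case by blast
  }
qed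

lemma ex_gap:
  fixes L :: "rat set"
  assumes "finite L"
  shows "\<exists>\<epsilon>>0. \<forall>r\<in>L. \<forall>s\<in>L. r < s \<longrightarrow> r < s - \<epsilon>"
proof -
  \<comment> \<open>Inserting 1 keeps the set of gaps nonempty when \<open>L\<close> has fewer than
    two elements. Half the minimum makes the inequality strict.\<close>
  let ?G = "insert 1 {s - r | r s. r \<in> L \<and> s \<in> L \<and> r < s}"
  have "{s - r | r s. r \<in> L \<and> s \<in> L \<and> r < s} \<subseteq> (\<lambda>(r, s). s - r) ` (L \<times> L)" by auto
  then have fin: "finite ?G" using assms by (meson finite_SigmaI finite_imageI finite_insert finite_subset)
  then have "Min ?G \<in> ?G" by (intro Min_in) auto
  then have pos: "Min ?G > 0" by auto
  have "r < s - Min ?G / 2" if "r \<in> L" "s \<in> L" "r < s" for r s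
  proof -
    have "Min ?G \<le> s - r" using fin that by (intro Min_le) auto
    then show ?thesis using pos by (simp add: field_simps)
  qed
  then show ?thesis using pos by (intro exI[of _ "Min ?G / 2"]) auto
qed

section \<open>Growing binary configurations and perturbing their last labels\<close>

context indiscernible_tree
begin

text \<open>After one split, the induction hypothesis grows the left chain to a full configuration
  with the right chain in the context, and then the right chain with the finished left copy in the
  context. Hence the induction is over all admissible \<open>K\<close>.\<close>

lemma good_all: "admissible K \<Longrightarrow> good K 0 \<Longrightarrow> good K n"
proof (induction n arbitrary: K)
  case (Suc n)
  note K = Suc.prems(1)
  have K1: "finite W" "lo < hi" "(labels W \<union> set u) \<inter> {lo<..<hi} = {}" if "K M W u lo hi" for M W u lo hi
    using K[unfolded admissible_def, THEN conjunct1, rule_format, OF that] by simp_all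
  have K2: "\<exists>W'\<subseteq>W. K M W' u lo hi" if "M \<le> M'" "K M' W u lo hi" for M M' W u lo hi
    using K[unfolded admissible_def, THEN conjunct2, THEN conjunct1, rule_format, OF that] .
  have K3: "\<exists>B. \<forall>W u lo hi. K M W u lo hi \<longrightarrow> card W \<le> B" for M
    using K[unfolded admissible_def, THEN conjunct2, THEN conjunct2] by blast
  \<comment> \<open>The data of one branching node above a context allowed by \<open>K\<close>: the
    stem \<open>y\<close>, the level \<open>i\<close> and the cut points \<open>c\<close> and
    \<open>m\<close>.\<close>
  define split where "split M W u lo hi y i c m \<longleftrightarrow> K M W u lo hi \<and> sorted_wrt (<) y \<and> set y \<subseteq> {lo<..<c} \<and>
     1 \<le> i \<and> i \<le> length y \<and> lo < c \<and> c < m \<and> m < hi" for M W u lo hi y and i :: nat and c m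
  \<comment> \<open>Contexts for the left side hold a right chain of the same length
    \<open>M\<close>. In \<open>KR\<close> below, contexts hold a left copy already grown to
    \<open>conf n\<close>.\<close>
  define KL where "KL M W' v c m \<longleftrightarrow> (\<exists>W u lo hi y i F2. split M W u lo hi y i c m \<and>
     conf 0 M (u @ y) m hi F2 \<and> W' = insert (u @ take i y) (W \<union> F2) \<and> v = u @ y)" for M W' v c m
  define KR where "KR M W' v m hi \<longleftrightarrow> (\<exists>W u lo y i c F1. split M W u lo hi y i c m \<and>
     conf n M (u @ y) c m F1 \<and> W' = insert (u @ take i y) (W \<union> F1) \<and> v = u @ y)" for M W' v m hi
  \<comment> \<open>Here \<open>a'\<close> and \<open>b'\<close> delimit the copy in the context,
    \<open>a\<close> and \<open>b\<close> the one still to be grown. No label of the enlarged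
    context enters the latter's interval.\<close>
  have lab: "(labels (insert (u @ take i y) (W \<union> F)) \<union> set (u @ y)) \<inter> {a<..<b} = {}"
    if "split M W u lo hi y i c m" "conf k M (u @ y) a' b' F" "lo \<le> a" "b \<le> hi" "c \<le> a"
      "{a'<..<b'} \<inter> {a<..<b} = {}" for M W u lo hi y i c m k a b a' b' F
  proof -
    have "labels (insert (u @ take i y) (W \<union> F)) \<union> set (u @ y)
        \<subseteq> (labels W \<union> set u) \<union> set y \<union> {a'<..<b'}"
      using conf_labels[OF that(2)] by (auto simp: labels_def dest: in_set_takeD)
    moreover have "(labels W \<union> set u) \<inter> {a<..<b} = {}"
      using that(1,3,4) K1(3)[of M W u lo hi] unfolding split_def by fastforce
    moreover have "set y \<inter> {a<..<b} = {}" using that(1,5) unfolding split_def by fastforce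
    ultimately show ?thesis using that(6) by blast
  qed
  have bnd: "\<exists>B. \<forall>W u lo hi y i F a b. K M W u lo hi \<longrightarrow> conf k M (u @ y) a b F \<longrightarrow>
      card (insert (u @ take i y) (W \<union> F)) \<le> B" for M k
  proof -
    obtain B B' where B: "\<And>W u lo hi. K M W u lo hi \<Longrightarrow> card W \<le> B"
      "\<And>u lo hi F. conf k M u lo hi F \<Longrightarrow> card F \<le> B'"
      using K3[of M] conf_card_bounded[of k M] by meson
    have "card (insert (u @ take i y) (W \<union> F)) \<le> Suc (B + B')"
      if "K M W u lo hi" "conf k M (u @ y) a b F" for W u lo hi y i F a b
    proof -
      have "card (insert (u @ take i y) (W \<union> F)) \<le> Suc (card (W \<union> F))"
        by (rule card_insert_le_m1) auto
      also have "card (W \<union> F) \<le> card W + card F" by (rule card_Un_le)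
      finally show ?thesis using B(1)[OF that(1)] B(2)[OF that(2)] by linarith
    qed
    then show ?thesis by blast
  qed
  have "admissible KL"
    unfolding admissible_def
  proof (intro conjI allI impI)
    fix M W' v c m assume "KL M W' v c m"
    then obtain W u lo hi y i F2 where *: "split M W u lo hi y i c m"
      "conf 0 M (u @ y) m hi F2" "W' = insert (u @ take i y) (W \<union> F2)" "v = u @ y"
      unfolding KL_def by blast
    show "finite W'" using * conf_finite[OF *(2)] K1(1) by (auto simp: split_def)
    show "c < m" using * by (simp add: split_def)
    show "(labels W' \<union> set v) \<inter> {c<..<m} = {}"
      unfolding *(3,4) by (rule lab[OF *(1,2)]) (use *(1) in \<open>auto simp: split_def\<close>)
  next
    fix M M' W' v c m assume le: "M \<le> M'" and "KL M' W' v c m"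
    then obtain W u lo hi y i F2 where *: "split M' W u lo hi y i c m"
      "conf 0 M' (u @ y) m hi F2" "W' = insert (u @ take i y) (W \<union> F2)" "v = u @ y"
      unfolding KL_def by blast
    obtain W1 where W1: "W1 \<subseteq> W" "K M W1 u lo hi" using K2[OF le] *(1) unfolding split_def by blast
    obtain F' where F': "F' \<subseteq> F2" "conf 0 M (u @ y) m hi F'" using conf_mono[OF le *(2)] by blast
    have "split M W1 u lo hi y i c m" using W1(2) *(1) by (simp add: split_def)
    then have "KL M (insert (u @ take i y) (W1 \<union> F')) v c m" unfolding KL_def using F'(2) *(4) by blast
    then show "\<exists>W\<subseteq>W'. KL M W v c m" using W1(1) F'(1) *(3) by (meson Un_mono insert_mono)
  next
    fix M
    obtain B where "\<forall>W u lo hi y i F a b. K M W u lo hi \<longrightarrow> conf 0 M (u @ y) a b F \<longrightarrow>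
      card (insert (u @ take i y) (W \<union> F)) \<le> B" using bnd by blast
    then show "\<exists>B. \<forall>W v c m. KL M W v c m \<longrightarrow> card W \<le> B"
      unfolding KL_def split_def by (intro exI[of _ B]) blast
  qed
  moreover have "good KL 0"
    unfolding good_def
  proof (intro allI impI)
    fix M :: nat assume "M > 0"
    then obtain W u lo hi F where *: "K M W u lo hi" "conf (Suc 0) M u lo hi F" "C (A ` (W \<union> F))"
      using good_split[OF Suc.prems] unfolding good_def One_nat_def by blast
    obtain y i c m F1 F2 where **: "sorted_wrt (<) y" "set y \<subseteq> {lo<..<c}"
       "1 \<le> i" "i \<le> length y" "lo < c" "c < m" "m < hi"
      "conf 0 M (u @ y) c m F1" "conf 0 M (u @ y) m hi F2" "F = insert (u @ take i y) (F1 \<union> F2)"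
      using *(2) unfolding conf.simps(2) by blast
    have "KL M (insert (u @ take i y) (W \<union> F2)) (u @ y) c m"
      unfolding KL_def split_def using * ** by blast
    moreover have "W \<union> F = insert (u @ take i y) (W \<union> F2) \<union> F1" using **(10) by auto
    ultimately show "\<exists>W u lo hi F. KL M W u lo hi \<and> conf 0 M u lo hi F \<and> C (A ` (W \<union> F))"
      using *(3) **(8) by metis
  qed
  ultimately have gL: "good KL n" by (rule Suc.IH)
  have "admissible KR"
    unfolding admissible_def
  proof (intro conjI allI impI)
    fix M W' v m hi assume "KR M W' v m hi"
    then obtain W u lo y i c F1 where *: "split M W u lo hi y i c m"
      "conf n M (u @ y) c m F1" "W' = insert (u @ take i y) (W \<union> F1)" "v = u @ y"
      unfolding KR_def by blast
    show "finite W'" using * conf_finite[OF *(2)] K1(1) by (auto simp: split_def)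
    show "m < hi" using * by (simp add: split_def)
    show "(labels W' \<union> set v) \<inter> {m<..<hi} = {}"
      unfolding *(3,4) by (rule lab[OF *(1,2)]) (use *(1) in \<open>auto simp: split_def\<close>)
  next
    fix M M' W' v m hi assume le: "M \<le> M'" and "KR M' W' v m hi"
    then obtain W u lo y i c F1 where *: "split M' W u lo hi y i c m"
      "conf n M' (u @ y) c m F1" "W' = insert (u @ take i y) (W \<union> F1)" "v = u @ y"
      unfolding KR_def by blast
    obtain W1 where W1: "W1 \<subseteq> W" "K M W1 u lo hi" using K2[OF le] *(1) unfolding split_def by blast
    obtain F' where F': "F' \<subseteq> F1" "conf n M (u @ y) c m F'" using conf_mono[OF le *(2)] by blast
    have "split M W1 u lo hi y i c m" using W1(2) *(1) by (simp add: split_def)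
    then have "KR M (insert (u @ take i y) (W1 \<union> F')) v m hi" unfolding KR_def using F'(2) *(4) by blast
    then show "\<exists>W\<subseteq>W'. KR M W v m hi" using W1(1) F'(1) *(3) by (meson Un_mono insert_mono)
  next
    fix M
    obtain B where "\<forall>W u lo hi y i F a b. K M W u lo hi \<longrightarrow> conf n M (u @ y) a b F \<longrightarrow>
      card (insert (u @ take i y) (W \<union> F)) \<le> B" using bnd by blast
    then show "\<exists>B. \<forall>W v m hi. KR M W v m hi \<longrightarrow> card W \<le> B"
      unfolding KR_def split_def by (intro exI[of _ B]) blast
  qed
  moreover have "good KR 0"
    unfolding good_def
  proof (intro allI impI)
    fix M :: nat assume "M > 0"
    then obtain W' v c m F1 where *: "KL M W' v c m" "conf n M v c m F1" "C (A ` (W' \<union> F1))"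
      using gL unfolding good_def by blast
    then obtain W u lo hi y i F2 where **: "split M W u lo hi y i c m"
      "conf 0 M (u @ y) m hi F2" "W' = insert (u @ take i y) (W \<union> F2)" "v = u @ y"
      unfolding KL_def by blast
    have "KR M (insert (u @ take i y) (W \<union> F1)) (u @ y) m hi"
      unfolding KR_def using * ** by blast
    \<comment> \<open>Regrouping: the grown left copy moves into the context and the right chain
      becomes the configuration to be grown.\<close>
    moreover have "W' \<union> F1 = insert (u @ take i y) (W \<union> F1) \<union> F2" using **(3) by auto
    ultimately show "\<exists>W u lo hi F. KR M W u lo hi \<and> conf 0 M u lo hi F \<and> C (A ` (W \<union> F))"
      using *(3) **(2) by metis
  qed
  ultimately have gR: "good KR n" by (rule Suc.IH)
  show ?case
    unfolding good_def
  proof (intro allI impI)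
    fix M :: nat assume "M > 0"
    then obtain W' v m hi F2 where *: "KR M W' v m hi" "conf n M v m hi F2" "C (A ` (W' \<union> F2))"
      using gR unfolding good_def by blast
    then obtain W u lo y i c F1 where **: "split M W u lo hi y i c m"
      "conf n M (u @ y) c m F1" "W' = insert (u @ take i y) (W \<union> F1)" "v = u @ y"
      unfolding KR_def by blast
    have "conf (Suc n) M u lo hi (insert (u @ take i y) (F1 \<union> F2))"
      unfolding conf.simps(2) using * ** unfolding split_def by blast
    moreover have "W' \<union> F2 = W \<union> insert (u @ take i y) (F1 \<union> F2)" using **(3) by auto
    moreover have "K M W u lo hi" using **(1) by (simp add: split_def)
    ultimately show "\<exists>W u lo hi F. K M W u lo hi \<and> conf (Suc n) M u lo hi F \<and> C (A ` (W \<union> F))"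
      using *(3) by metis
  qed
qed

text \<open>Starts from the empty context, where \<open>branch\<close> makes chains of every length
  consistent.\<close>

lemma ex_consistent_conf: "\<exists>F. conf n 1 [] 0 1 F \<and> C (A ` F)"
proof -
  define K where "K M W u lo hi \<longleftrightarrow> W = {} \<and> u = [] \<and> lo = 0 \<and> hi = 1"
    for M :: nat and W :: "rat list set" and u :: "rat list" and lo hi :: rat
  have "admissible K" by (auto simp: admissible_def K_def labels_def)
  moreover have "good K 0"
    unfolding good_def
  proof (intro allI impI)
    fix M :: nat
    let ?F = "(\<lambda>j. [] @ take j (grid 0 1 M)) ` {1..M}"
    have "conf 0 M [] 0 1 ?F"
      unfolding conf.simps using sorted_grid[of 0 1 M] set_grid[of 0 1 M]
      by (intro exI[of _ "grid 0 1 M"] exI[of _ "{1..M}"]) auto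
    moreover have "C (A ` ?F)"
      by (rule C_mono[OF branch[of "grid 0 1 M"]]) (auto simp: take_is_prefix)
    ultimately show "\<exists>W u lo hi F. K M W u lo hi \<and> conf 0 M u lo hi F \<and> C (A ` (W \<union> F))"
      unfolding K_def by (metis Un_empty_left)
  qed
  ultimately have "good K n" by (rule good_all)
  then show ?thesis unfolding good_def K_def by (metis Un_empty_left zero_less_one)
qed

text \<open>Lowering the last label of each \<open>z \<eta>\<close> by less than every gap between
  labels acts on an antichain as one increasing relabelling, but sets each node against those above
  it, which keep the old label.\<close>

lemma ex_finite_antichain_tree:
  "\<exists>b :: bool list \<Rightarrow> 'p. range b \<subseteq> D \<and>
     (\<forall>X. (\<forall>\<eta>\<in>X. length \<eta> \<le> n) \<longrightarrow> (\<forall>\<eta>\<in>X. \<forall>\<nu>\<in>X. \<not> strict_prefix \<eta> \<nu>) \<longrightarrow> C (b ` X)) \<and>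
     (\<forall>\<eta> \<nu>. length \<eta> \<le> n \<longrightarrow> length \<nu> \<le> n \<longrightarrow> strict_prefix \<eta> \<nu> \<longrightarrow> \<not> C {b \<eta>, b \<nu>})"
proof -
  obtain F where F: "conf n 1 [] 0 1 F" "C (A ` F)" using ex_consistent_conf by blast
  have disj: "set [] \<inter> {0<..<1 :: rat} = {}" by simp
  obtain z :: "bool list \<Rightarrow> rat list" where z': "\<forall>\<eta>. length \<eta> \<le> n \<longrightarrow> z \<eta> \<in> F \<and> strict_prefix [] (z \<eta>) \<and> last (z \<eta>) \<in> {0<..<1}"
    "\<forall>\<eta> \<nu>. length \<eta> \<le> n \<longrightarrow> length \<nu> \<le> n \<longrightarrow> strict_prefix \<eta> \<nu> \<longrightarrow> strict_prefix (z \<eta>) (z \<nu>)"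
    "\<forall>\<eta> \<nu>. length \<eta> \<le> n \<longrightarrow> length \<nu> \<le> n \<longrightarrow> last (z \<nu>) \<in> set (butlast (z \<eta>)) \<longrightarrow> strict_prefix \<nu> \<eta>"
    using conf_skeleton[OF F(1) zero_less_one disj] by (elim exE conjE)
  note z = z'[rule_format]
  have z_ne: "z \<eta> \<noteq> []" if "length \<eta> \<le> n" for \<eta> using z(1)[OF that] by auto
  have fin: "finite F" using F(1) by (rule conf_finite)
  obtain \<epsilon> where \<epsilon>: "\<epsilon> > 0" "\<And>r s. r \<in> labels F \<Longrightarrow> s \<in> labels F \<Longrightarrow> r < s \<Longrightarrow> r < s - \<epsilon>"
    using ex_gap[OF finite_labels[OF fin]] by blast
  define b where "b \<eta> = A (butlast (z \<eta>) @ [last (z \<eta>) - \<epsilon>])" for \<eta>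
  have "C (b ` X)" if X: "\<forall>\<eta>\<in>X. length \<eta> \<le> n" "\<forall>\<eta>\<in>X. \<forall>\<nu>\<in>X. \<not> strict_prefix \<eta> \<nu>" for X
  proof -
    define T where "T = (last \<circ> z) ` X"
    \<comment> \<open>Only last labels from \<open>X\<close> move. By \<open>z(3)\<close> none of
      them occurs earlier in a node from \<open>X\<close>, so \<open>\<pi>\<close> changes each such
      node in its last entry alone.\<close>
    define \<pi> where "\<pi> r = (if r \<in> T then r - \<epsilon> else r)" for r
    have zX: "z ` X \<subseteq> F" using z(1) X(1) by auto
    have fz: "finite (z ` X)" using zX fin by (rule finite_subset)
    have lab: "labels (z ` X) \<subseteq> labels F" using zX by (auto simp: labels_def)
    have "strict_mono_on (labels (z ` X)) \<pi>"
    proof (rule strict_mono_onI)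
      fix r s assume "r \<in> labels (z ` X)" "s \<in> labels (z ` X)" "r < s"
      then have "r < s - \<epsilon>" using \<epsilon>(2) lab by blast
      then show "\<pi> r < \<pi> s" using \<epsilon>(1) by (auto simp: \<pi>_def)
    qed
    moreover have "C (A ` z ` X)" by (rule C_mono[OF F(2)]) (use zX in blast)
    ultimately have "C (A ` map \<pi> ` z ` X)" by (intro indisc fz)
    moreover have "map \<pi> (z \<eta>) = butlast (z \<eta>) @ [last (z \<eta>) - \<epsilon>]" if \<eta>: "\<eta> \<in> X" for \<eta>
    proof -
      have ne: "z \<eta> \<noteq> []" using z_ne X(1) \<eta> by blast
      have "r \<notin> T" if "r \<in> set (butlast (z \<eta>))" for r
      proof
        assume "r \<in> T"
        then obtain \<nu> where "\<nu> \<in> X" "r = last (z \<nu>)" by (auto simp: T_def)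
        then show False using z(3)[of \<eta> \<nu>] X \<eta> that by blast
      qed
      then have "map \<pi> (butlast (z \<eta>)) = butlast (z \<eta>)" by (intro map_idI) (auto simp: \<pi>_def)
      moreover have "\<pi> (last (z \<eta>)) = last (z \<eta>) - \<epsilon>" using \<eta> by (auto simp: \<pi>_def T_def)
      ultimately have "map \<pi> (butlast (z \<eta>) @ [last (z \<eta>)]) = butlast (z \<eta>) @ [last (z \<eta>) - \<epsilon>]" by simp
      then show ?thesis using ne by simp
    qed
    then have "A ` map \<pi> ` z ` X = b ` X" unfolding image_image b_def by (intro image_cong) auto
    ultimately show ?thesis by simp
  qed
  moreover have "\<not> C {b \<eta>, b \<nu>}" if len: "length \<eta> \<le> n" "length \<nu> \<le> n" and pre: "strict_prefix \<eta> \<nu>" for \<eta> \<nu>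
  proof -
    have ne: "z \<eta> \<noteq> []" "z \<nu> \<noteq> []" using z_ne len by blast+
    have "strict_prefix (z \<eta>) (z \<nu>)" using z(2)[OF len pre] .
    then obtain w a where "z \<nu> = z \<eta> @ w @ [a]"
      by (metis append_butlast_last_id append_self_conv prefix_order.less_imp_le prefixE strict_prefix_def)
    then have "butlast (z \<nu>) = butlast (z \<eta>) @ [last (z \<eta>)] @ w"
      using ne by (simp add: butlast_append)
    \<comment> \<open>At the place where \<open>b \<eta>\<close> ends with the lowered label,
      \<open>b \<nu>\<close> still has the original one, and \<open>sibling\<close> applies.\<close>
    then have "b \<nu> = A (butlast (z \<eta>) @ [last (z \<eta>)] @ (w @ [last (z \<nu>) - \<epsilon>]))" by (simp add: b_def)
    then show ?thesis
      using sibling[of "last (z \<eta>) - \<epsilon>" "last (z \<eta>)" "butlast (z \<eta>)"] \<epsilon>(1) by (simp add: b_def)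
  qed
  moreover have "range b \<subseteq> D" using A_D by (auto simp: b_def)
  ultimately show ?thesis by blast
qed

text \<open>Finite antichains and comparable pairs are finite index sets, and finitely many of them
  lie within some depth \<open>n\<close>.\<close>

lemma ex_antichain_tree:
  "\<exists>b :: bool list \<Rightarrow> 'p. range b \<subseteq> D \<and>
     (\<forall>X. finite X \<longrightarrow> (\<forall>\<eta>\<in>X. \<forall>\<nu>\<in>X. \<not> strict_prefix \<eta> \<nu>) \<longrightarrow> C (b ` X)) \<and>
     (\<forall>\<eta> \<nu>. strict_prefix \<eta> \<nu> \<longrightarrow> \<not> C {b \<eta>, b \<nu>})"
proof -
  let ?T = "{X :: bool list set. finite X \<and> (\<forall>\<eta>\<in>X. \<forall>\<nu>\<in>X. \<not> strict_prefix \<eta> \<nu>)}"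
  let ?G = "{{\<eta>, \<nu>} | \<eta> \<nu> :: bool list. strict_prefix \<eta> \<nu>}"
  have "\<exists>b. range b \<subseteq> D \<and> (\<forall>X\<in>?T. C (b ` X)) \<and> (\<forall>X\<in>?G. \<not> C (b ` X))"
  proof (rule compact)
    fix T G assume T: "T \<subseteq> ?T" "finite T" and G: "G \<subseteq> ?G" "finite G"
    have "finite (length ` (\<Union>T \<union> \<Union>G))" using T G by (intro finite_imageI finite_UnI finite_Union) auto
    then obtain n where n: "\<forall>k\<in>length ` (\<Union>T \<union> \<Union>G). k \<le> n" unfolding finite_nat_set_iff_bounded_le by (elim exE)
    then have len: "length \<eta> \<le> n" if "\<eta> \<in> \<Union>T \<union> \<Union>G" for \<eta> using that by blast
    obtain b :: "bool list \<Rightarrow> 'p" where b: "range b \<subseteq> D"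
      "\<forall>X. (\<forall>\<eta>\<in>X. length \<eta> \<le> n) \<longrightarrow> (\<forall>\<eta>\<in>X. \<forall>\<nu>\<in>X. \<not> strict_prefix \<eta> \<nu>) \<longrightarrow> C (b ` X)"
      "\<forall>\<eta> \<nu>. length \<eta> \<le> n \<longrightarrow> length \<nu> \<le> n \<longrightarrow> strict_prefix \<eta> \<nu> \<longrightarrow> \<not> C {b \<eta>, b \<nu>}"
      using ex_finite_antichain_tree[of n] by (elim exE conjE)
    have "C (b ` X)" if X: "X \<in> T" for X
    proof (rule b(2)[rule_format])
      show "length \<eta> \<le> n" if "\<eta> \<in> X" for \<eta> using that X by (intro len) blast
      show "\<not> strict_prefix \<eta> \<nu>" if "\<eta> \<in> X" "\<nu> \<in> X" for \<eta> \<nu> using that X T(1) by blast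
    qed
    moreover have "\<not> C (b ` X)" if X: "X \<in> G" for X
    proof -
      obtain \<eta> \<nu> where "X = {\<eta>, \<nu>}" "strict_prefix \<eta> \<nu>" using X G(1) by blast
      moreover from this have "length \<eta> \<le> n" "length \<nu> \<le> n" using X by (blast intro: len)+
      ultimately show ?thesis using b(3) by simp
    qed
    ultimately show "\<exists>b. range b \<subseteq> D \<and> (\<forall>X\<in>T. C (b ` X)) \<and> (\<forall>X\<in>G. \<not> C (b ` X))"
      using b(1) by blast
  qed auto
  then obtain b where b: "range b \<subseteq> D" "\<forall>X\<in>?T. C (b ` X)" "\<forall>X\<in>?G. \<not> C (b ` X)" by blast
  have "\<not> C {b \<eta>, b \<nu>}" if "strict_prefix \<eta> \<nu>" for \<eta> \<nu>
  proof -
    have "{\<eta>, \<nu>} \<in> ?G" using that by blast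
    then have "\<not> C (b ` {\<eta>, \<nu>})" using b(3) by blast
    then show ?thesis by simp
  qed
  then show ?thesis using b(1,2) by (intro exI[of _ b]) simp
qed

end

section \<open>SOP1 and SOP2\<close>

context compact_consistency
begin

text \<open>Compactness with the pairs of a vertex and a number as indices. Finitely many chains and
  incomparable pairs lie within some depth \<open>d\<close>.\<close>

lemma ex_SOP2_tree_if_finite:
  assumes fin: "\<And>d. \<exists>t. SOP2_tree_to n d t"
  shows "\<exists>t :: bool list \<Rightarrow> nat \<Rightarrow> 'p. (\<forall>\<eta> i. t \<eta> i \<in> D) \<and> (\<forall>\<eta>. C (\<Union>\<sigma>\<in>{\<sigma>. prefix \<sigma> \<eta>}. t \<sigma> ` {..n})) \<and>
    (\<forall>\<eta> \<nu>. \<eta> \<parallel> \<nu> \<longrightarrow> \<not> C (t \<eta> ` {..n} \<union> t \<nu> ` {..n}))"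
proof -
  define ch where "ch \<eta> = {\<sigma>. prefix \<sigma> \<eta>} \<times> {..n}" for \<eta> :: "bool list"
  define pr where "pr \<eta> \<nu> = {\<eta>, \<nu>} \<times> {..n}" for \<eta> \<nu> :: "bool list"
  have ch: "b ` ch \<eta> = (\<Union>\<sigma>\<in>{\<sigma>. prefix \<sigma> \<eta>}. (\<lambda>i. b (\<sigma>, i)) ` {..n})" for b :: "_ \<Rightarrow> 'p" and \<eta>
    by (auto simp: ch_def)
  have pr: "b ` pr \<eta> \<nu> = (\<lambda>i. b (\<eta>, i)) ` {..n} \<union> (\<lambda>i. b (\<nu>, i)) ` {..n}" for b :: "_ \<Rightarrow> 'p" and \<eta> \<nu>
    by (auto simp: pr_def)
  have "\<exists>b. range b \<subseteq> D \<and> (\<forall>X\<in>range ch. C (b ` X)) \<and> (\<forall>X\<in>(\<lambda>(\<eta>, \<nu>). pr \<eta> \<nu>) ` {(\<eta>, \<nu>). \<eta> \<parallel> \<nu>}. \<not> C (b ` X))"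
  proof (rule compact)
    fix X assume "X \<in> range ch \<union> (\<lambda>(\<eta>, \<nu>). pr \<eta> \<nu>) ` {(\<eta>, \<nu>). \<eta> \<parallel> \<nu>}"
    moreover have "finite {\<sigma>. prefix \<sigma> \<eta>}" for \<eta> :: "bool list"
      by (metis List.finite_set set_prefixes_eq)
    ultimately show "finite X" by (auto simp: ch_def pr_def)
  next
    fix T G assume TG: "T \<subseteq> range ch" "G \<subseteq> (\<lambda>(\<eta>, \<nu>). pr \<eta> \<nu>) ` {(\<eta>, \<nu>). \<eta> \<parallel> \<nu>}" "finite T" "finite G"
    obtain T0 where T0: "finite T0" "T = ch ` T0" using TG(1,3) by (meson finite_subset_image)
    obtain G0 where G0: "G0 \<subseteq> {(\<eta>, \<nu>). \<eta> \<parallel> \<nu>}" "finite G0" "G = (\<lambda>(\<eta>, \<nu>). pr \<eta> \<nu>) ` G0"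
      using TG(2,4) by (meson finite_subset_image)
    let ?L = "length ` (T0 \<union> fst ` G0 \<union> snd ` G0)"
    obtain d where d: "\<forall>k\<in>?L. k \<le> d"
      using finite_nat_set_iff_bounded_le[of ?L] T0(1) G0(2) by auto
    obtain t :: "bool list \<Rightarrow> nat \<Rightarrow> 'p" where t': "\<forall>\<eta>. t \<eta> ` {..n} \<subseteq> D"
      "\<forall>\<eta>. length \<eta> = d \<longrightarrow> C (\<Union>\<sigma>\<in>{\<sigma>. prefix \<sigma> \<eta>}. t \<sigma> ` {..n})"
      "\<forall>\<eta> \<nu>. length \<eta> \<le> d \<longrightarrow> length \<nu> \<le> d \<longrightarrow> \<eta> \<parallel> \<nu> \<longrightarrow> \<not> C (t \<eta> ` {..n} \<union> t \<nu> ` {..n})"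
      using fin[of d] unfolding SOP2_tree_to_def by (elim exE conjE)
    note t = t'[rule_format]
    \<comment> \<open>Capping the index at \<open>n\<close> keeps the range in \<open>D\<close>, as
      the values beyond \<open>n\<close> are junk.\<close>
    define b where "b = (\<lambda>(\<eta>, i). t \<eta> (min i n))"
    have bt: "(\<lambda>i. b (\<eta>, i)) ` {..n} = t \<eta> ` {..n}" for \<eta>
      unfolding b_def by (intro image_cong) auto
    have "range b \<subseteq> D" using t(1) by (fastforce simp: b_def)
    moreover have "C (b ` X)" if X: "X \<in> T" for X
    proof -
      obtain \<eta> where \<eta>: "X = ch \<eta>" "\<eta> \<in> T0" using X T0(2) by blast
      have "length \<eta> \<le> d" using \<eta>(2) d by auto
      \<comment> \<open>Consistency is known for chains up to depth exactly \<open>d\<close>, so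
        \<open>\<eta>\<close> is padded.\<close>
      then have "length (\<eta> @ replicate (d - length \<eta>) False) = d" by simp
      from t(2)[OF this] show ?thesis
        unfolding \<eta>(1) ch bt by (rule C_mono) (intro UN_mono, auto)
    qed
    moreover have "\<not> C (b ` X)" if X: "X \<in> G" for X
    proof -
      obtain \<eta> \<nu> where *: "X = pr \<eta> \<nu>" "(\<eta>, \<nu>) \<in> G0" using X G0(3) by auto
      then have "\<eta> \<parallel> \<nu>" using G0(1) by auto
      moreover have "length \<eta> \<le> d" "length \<nu> \<le> d" using *(2) d by force+
      ultimately show ?thesis using t(3) unfolding *(1) pr bt by blast
    qed
    ultimately show "\<exists>b. range b \<subseteq> D \<and> (\<forall>X\<in>T. C (b ` X)) \<and> (\<forall>X\<in>G. \<not> C (b ` X))" by blast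
  qed
  then obtain b where b: "range b \<subseteq> D" "\<And>\<eta>. C (b ` ch \<eta>)" "\<And>\<eta> \<nu>. \<eta> \<parallel> \<nu> \<Longrightarrow> \<not> C (b ` pr \<eta> \<nu>)"
    by auto
  have "\<not> C ((\<lambda>i. b (\<eta>, i)) ` {..n} \<union> (\<lambda>i. b (\<nu>, i)) ` {..n})" if "\<eta> \<parallel> \<nu>" for \<eta> \<nu>
    using b(3)[OF that] unfolding pr .
  then show ?thesis using b(1) b(2)[unfolded ch]
    by (intro exI[of _ "\<lambda>\<eta> i. b (\<eta>, i)"]) auto
qed

end

lemma take_drop_concat:
  assumes "\<forall>xs\<in>set xss. length xs = l" "i < length xss"
  shows "take l (drop (i * l) (concat xss)) = xss ! i"
  using assms
proof (induction xss arbitrary: i)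
  case (Cons xs xss)
  then show ?case by (cases i) auto
qed simp

lemma tle_iff_prefix: "\<eta> \<unlhd> \<nu> \<longleftrightarrow> prefix \<eta> \<nu>"
  by (simp add: tle_def prefix_def)

lemma prefix_restr: "k \<le> k' \<Longrightarrow> prefix (restr f k) (restr f k')"
  unfolding restr_def by (metis le_Suc_ex map_mono_prefix prefixI upt_add_eq_append zero_le)

text \<open>Concatenating the \<open>n + 1\<close> tuples at each vertex gives the parameters of the
  conjunction. A finite part of a branch lies below some \<open>restr f m\<close>, where
  \<open>path\<close> applies.\<close>

lemma has_SOP2_conj_relI:
  fixes t :: "bool list \<Rightarrow> nat \<Rightarrow> 'm list"
  assumes t: "\<And>\<eta> i. length (t \<eta> i) = l \<and> set (t \<eta> i) \<subseteq> dom M"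
    and path: "\<And>\<eta>. jointly_sat M k R (\<Union>\<sigma>\<in>{\<sigma>. prefix \<sigma> \<eta>}. t \<sigma> ` {..n})"
    and incomp: "\<And>\<eta> \<nu>. \<eta> \<parallel> \<nu> \<Longrightarrow> \<not> jointly_sat M k R (t \<eta> ` {..n} \<union> t \<nu> ` {..n})"
  shows "has_SOP2 M k (Suc n * l) (conj_rel R l n)"
proof -
  define c where "c \<eta> = concat (map (t \<eta>) [0..<Suc n])" for \<eta>
  have "sum_list (map (\<lambda>i. length (t \<eta> i)) is) = length is * l" for \<eta> "is"
    using t by (induction "is") auto
  then have len: "length (c \<eta>) = Suc n * l" for \<eta> by (simp only: c_def length_concat map_map comp_def) simp
  have blk: "take l (drop (i * l) (c \<eta>)) = t \<eta> i" if "i \<le> n" for \<eta> i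
  proof -
    have "take l (drop (i * l) (c \<eta>)) = map (t \<eta>) [0..<Suc n] ! i"
      unfolding c_def using t that by (intro take_drop_concat) auto
    also have "\<dots> = t \<eta> i" using that by (subst nth_map) (auto simp del: upt_Suc)
    finally show ?thesis .
  qed
  have rel: "conj_rel R l n a (c \<eta>) \<longleftrightarrow> (\<forall>b\<in>t \<eta> ` {..n}. R a b)" for a \<eta>
    using len blk by (auto simp: conj_rel_def)
  have "params_in M (Suc n * l) c"
    using t len unfolding params_in_def c_def by fastforce
  moreover have "consistent M k (conj_rel R l n) {c (restr f j) | j. True}" for f
    unfolding consistent_iff
  proof (intro allI impI)
    fix F assume F: "F \<subseteq> {c (restr f j) | j. True}" "finite F"
    then have "F \<subseteq> (\<lambda>j. c (restr f j)) ` UNIV" by auto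
    then obtain I where I: "finite I" "F = (\<lambda>j. c (restr f j)) ` I" using F(2) by (meson finite_subset_image)
    obtain m where m: "\<forall>j\<in>I. j \<le> m" using I(1) finite_nat_set_iff_bounded_le by blast
    obtain a where a: "length a = k" "set a \<subseteq> dom M"
      "\<forall>b\<in>(\<Union>\<sigma>\<in>{\<sigma>. prefix \<sigma> (restr f m)}. t \<sigma> ` {..n}). R a b"
      using path[of "restr f m"] unfolding jointly_sat_def by blast
    have "conj_rel R l n a (c (restr f j))" if "j \<in> I" for j
      unfolding rel using a(3) prefix_restr[of j m f] m that by blast
    then show "jointly_sat M k (conj_rel R l n) F" unfolding jointly_sat_def using a I(2) by blast
  qed
  moreover have "\<not> consistent M k (conj_rel R l n) {c \<eta>, c \<nu>}" if "\<not> \<eta> \<unlhd> \<nu> \<and> \<not> \<nu> \<unlhd> \<eta>" for \<eta> \<nu>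
  proof
    assume "consistent M k (conj_rel R l n) {c \<eta>, c \<nu>}"
    then obtain a where "length a = k" "set a \<subseteq> dom M" "conj_rel R l n a (c \<eta>)" "conj_rel R l n a (c \<nu>)"
      by (auto simp: consistent_finite_iff jointly_sat_def)
    then have "jointly_sat M k R (t \<eta> ` {..n} \<union> t \<nu> ` {..n})"
      unfolding rel jointly_sat_def by blast
    moreover have "\<eta> \<parallel> \<nu>" using that by (auto simp: tle_iff_prefix)
    ultimately show False using incomp by blast
  qed
  ultimately show ?thesis unfolding has_SOP2_def SOP2_witness_def by blast
qed

text \<open>Embeds the tree of finite sequences of naturals into the binary tree so that
  \<open>u @ [x]\<close> and \<open>u @ [y] @ w\<close> with \<open>x < y\<close> become an inconsistent pair of SOP1.\<close>
fun comb :: "nat list \<Rightarrow> bool list" where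
  "comb [] = []"
| "comb (x # s) = replicate x False @ True # comb s"

lemma comb_append: "comb (s @ s') = comb s @ comb s'"
  by (induction s) auto

text \<open>The finite sequence continued by zeros is a branch through all its initial
  segments.\<close>

lemma restr_nth: "j \<le> length s \<Longrightarrow> restr (\<lambda>i. i < length s \<and> s ! i) j = take j s"
  by (rule nth_equalityI) (auto simp: restr_def)

theorem theorem4p8:
  fixes M :: "('m, 'f, 'r) struc" and \<phi> :: "('f, 'r) form" and xs ys :: "nat list"
  assumes "is_struc M"
    and "aleph1_saturated M"
    and "distinct xs" and "distinct ys" and "set xs \<inter> set ys = {}"
    and "fv \<phi> \<subseteq> set xs \<union> set ys"
    and "has_SOP1 M (length xs) (length ys) (holds M \<phi> xs ys)"
    and "\<forall>n. \<not> has_SOP2 M (length xs) (Suc n * length ys)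
                 (conj_rel (holds M \<phi> xs ys) (length ys) n)"
  shows "\<exists>b. params_in M (length ys) b \<and> antichain_tree M (length xs) (holds M \<phi> xs ys) b"
proof -
  define k l R where "k = length xs" and "l = length ys" and "R = holds M \<phi> xs ys"
  define D where "D = {b. length b = l \<and> set b \<subseteq> dom M}"
  define C where "C = jointly_sat M k R"
  interpret compact_consistency D C
  proof
    show "C B \<Longrightarrow> B' \<subseteq> B \<Longrightarrow> C B'" for B B' unfolding C_def by (rule jointly_sat_mono)
  qed (use jointly_sat_compact[OF assms(1-6) k_def l_def R_def D_def] in \<open>simp add: C_def\<close>)
  obtain a where a: "params_in M l a" "\<And>f. consistent M k R {a (restr f n) | n. True}"
    "\<And>\<eta> \<nu>. \<not> consistent M k R {a (\<eta> @ [True]), a (\<eta> @ [False] @ \<nu>)}"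
    using assms(7) unfolding has_SOP1_def SOP1_witness_def k_def l_def R_def by blast
  define A0 where "A0 = a \<circ> comb"
  have A0_D: "range A0 \<subseteq> D" using a(1) by (auto simp: A0_def D_def params_in_def)
  have A0_branch: "C (A0 ` {t. prefix t s})" for s
  proof -
    let ?f = "\<lambda>i. i < length (comb s) \<and> comb s ! i"
    have "A0 t \<in> {a (restr ?f n) | n. True}" if pre: "prefix t s" for t
    proof -
      obtain w where "s = t @ w" using pre by (auto simp: prefix_def)
      then have "restr ?f (length (comb t)) = comb t" by (subst restr_nth) (auto simp: comb_append)
      then have "A0 t = a (restr ?f (length (comb t)))" by (simp add: A0_def)
      then show ?thesis by blast
    qed
    then have "A0 ` {t. prefix t s} \<subseteq> {a (restr ?f n) | n. True}" by blast
    moreover have "finite {t. prefix t s}" by (metis List.finite_set set_prefixes_eq)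
    ultimately show ?thesis using a(2)[of ?f] unfolding consistent_iff C_def by blast
  qed
  have A0_sibling: "\<not> C {A0 (u @ [x]), A0 (u @ [y] @ w)}" if "x < y" for u x y w
  proof -
    \<comment> \<open>The two combs separate after \<open>comb u @ replicate x False\<close>: the
      one for \<open>x\<close> turns to \<open>True\<close>, the one for the larger \<open>y\<close>
      goes on with \<open>False\<close>.\<close>
    have "replicate y False = replicate x False @ [False] @ replicate (y - Suc x) False"
      using that by (metis Suc_diff_Suc append_Cons append_Nil le_add_diff_inverse less_imp_le
          replicate_Suc replicate_add)
    then have "comb (u @ [y] @ w) =
        (comb u @ replicate x False) @ [False] @ (replicate (y - Suc x) False @ True # comb w)"
      by (simp add: comb_append)
    moreover have "comb (u @ [x]) = (comb u @ replicate x False) @ [True]" by (simp add: comb_append)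
    ultimately show ?thesis
      using a(3) consistent_finite_iff unfolding C_def A0_def comp_def
      by (metis finite.emptyI finite.insertI)
  qed
  obtain A :: "rat list \<Rightarrow> 'm list" where A: "range A \<subseteq> D" "\<forall>s. C (A ` {t. prefix t s})"
    "\<forall>u x y w. x < y \<longrightarrow> \<not> C {A (u @ [x]), A (u @ [y] @ w)}"
    "\<forall>F \<pi>. finite F \<longrightarrow> strict_mono_on (labels F) \<pi> \<longrightarrow> C (A ` F) \<longrightarrow> C (A ` map \<pi> ` F)"
    by (atomize_elim, rule ex_indiscernible[OF A0_D A0_branch A0_sibling])
  have no_SOP2: "\<exists>d. \<forall>t. \<not> SOP2_tree_to n d t" for n
  proof (rule ccontr)
    assume "\<not> ?thesis"
    then have "\<exists>t. SOP2_tree_to n d t" for d by blast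
    note ex_SOP2_tree_if_finite[OF this]
    then obtain t :: "bool list \<Rightarrow> nat \<Rightarrow> 'm list" where t: "\<forall>\<eta> i. t \<eta> i \<in> D" "\<forall>\<eta>. C (\<Union>\<sigma>\<in>{\<sigma>. prefix \<sigma> \<eta>}. t \<sigma> ` {..n})"
      "\<forall>\<eta> \<nu>. \<eta> \<parallel> \<nu> \<longrightarrow> \<not> C (t \<eta> ` {..n} \<union> t \<nu> ` {..n})" by (elim exE conjE)
    have "has_SOP2 M k (Suc n * l) (conj_rel R l n)"
      by (rule has_SOP2_conj_relI[of t]) (use t in \<open>auto simp: D_def C_def\<close>)
    then show False using assms(8) unfolding k_def l_def R_def by blast
  qed
  interpret indiscernible_tree D C A
  proof
    show "range A \<subseteq> D" by (rule A(1))
    show "C (A ` {t. prefix t s})" for s by (rule A(2)[rule_format])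
    show "\<not> C {A (u @ [x]), A (u @ [y] @ w)}" if "x < y" for x y u w
      using that by (rule A(3)[rule_format])
    show "C (A ` map \<pi> ` F)" if "finite F" "strict_mono_on (labels F) \<pi>" "C (A ` F)" for F \<pi>
      using that by (rule A(4)[rule_format])
    show "\<exists>d. \<forall>t. \<not> SOP2_tree_to n d t" for n by (rule no_SOP2)
  qed
  obtain b :: "bool list \<Rightarrow> 'm list" where b: "range b \<subseteq> D"
    and b_antichain: "\<forall>X. finite X \<longrightarrow> (\<forall>\<eta>\<in>X. \<forall>\<nu>\<in>X. \<not> strict_prefix \<eta> \<nu>) \<longrightarrow> C (b ` X)"
    and b_comparable: "\<forall>\<eta> \<nu>. strict_prefix \<eta> \<nu> \<longrightarrow> \<not> C {b \<eta>, b \<nu>}"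
    using ex_antichain_tree by (elim exE conjE)
  have "params_in M l b" using b by (auto simp: params_in_def D_def)
  moreover have "antichain_tree M k R b"
    unfolding antichain_tree_def
  proof (intro allI iffI)
    fix X assume cons: "consistent M k R (b ` X)"
    have "\<not> prefix \<eta> \<nu>" if "\<eta> \<in> X" "\<nu> \<in> X" "\<eta> \<noteq> \<nu>" for \<eta> \<nu>
    proof
      assume "prefix \<eta> \<nu>"
      then have "\<not> C {b \<eta>, b \<nu>}" using that(3) by (intro b_comparable[rule_format]) (simp add: strict_prefix_def)
      moreover have "{b \<eta>, b \<nu>} \<subseteq> b ` X" using that by simp
      ultimately show False using cons unfolding consistent_iff C_def by blast
    qed
    then show "\<forall>\<eta>\<in>X. \<forall>\<nu>\<in>X. \<eta> \<noteq> \<nu> \<longrightarrow> \<not> \<eta> \<unlhd> \<nu> \<and> \<not> \<nu> \<unlhd> \<eta>"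
      unfolding tle_iff_prefix by blast
  next
    fix X assume anti: "\<forall>\<eta>\<in>X. \<forall>\<nu>\<in>X. \<eta> \<noteq> \<nu> \<longrightarrow> \<not> \<eta> \<unlhd> \<nu> \<and> \<not> \<nu> \<unlhd> \<eta>"
    show "consistent M k R (b ` X)"
      unfolding consistent_iff
    proof (intro allI impI)
      fix F assume "F \<subseteq> b ` X" "finite F"
      \<comment> \<open>Consistency of an infinite antichain concerns its finite subsets, which are
        finite antichains.\<close>
      then obtain Y where Y: "Y \<subseteq> X" "finite Y" "F = b ` Y" by (meson finite_subset_image)
      have "\<forall>\<eta>\<in>Y. \<forall>\<nu>\<in>Y. \<not> strict_prefix \<eta> \<nu>"
        using anti Y(1) unfolding tle_iff_prefix strict_prefix_def by blast
      then show "jointly_sat M k R F" using b_antichain Y(2,3) by (simp add: C_def)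
    qed
  qed
  ultimately show ?thesis unfolding k_def l_def R_def by blast
qed

end
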